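(* Let $\theta\in\mathbb{R}$ and let $A$ be an $n\times n$ real symmetric acyclic matrix. Let $F$ be the graph with vertex set $V(G_{A})\setminus \mathcal{N}_{\theta}^{\circ}(A)$ and edge set $E(G_{A})\setminus\mathcal{E}_{\theta}^{\circ}(A)$, and let $d_F(u)$ denote the degree of $u$ in $F$. Then (i) $A\in \mathcal{A}_{\theta}$; (ii) $m_{\theta}(A)=c+\sum_{u\in \partial \mathcal{N}_{\theta}(A)}(d_{F}(u)-2)$, where $c$ is the number of connected components of $F$; (iii) $m_{\theta}(A)=\big|\{\text{connected components of } F-\partial \mathcal{N}_{\theta}(A)\}\big|-|\partial \mathcal{N}_{\theta}(A)|$.
   Context: For $M=[m_{ij}]$ a real symmetric $n\times n$ matrix, $G_M$ is the simple graph on vertex set $[n]=\{1,\dots,n\}$ in which $i\neq j$ are adjacent iff $m_{ij}\neq 0$. $M$ is acyclic if $G_M$ is a forest. $m_\theta(M)$ denotes the multiplicity of $\theta$ as an eigenvalue of $M$ (it is $0$ if $\theta$ is not an eigenvalue). A $\theta$-eigenvector of $M$ is a vector $x$ with $Mx=\theta x$. The nodal vertex set is $\mathcal{N}_{\theta}(M)=\{u\in V(G_M): x_u=0 \text{ for every } x \text{ with } Mx=\theta x\}$; $\mathcal{N}_{\theta}^{\circ}(M)=\{u\in \mathcal{N}_{\theta}(M): N_{G_M}(u)\subseteq \mathcal{N}_{\theta}(M)\}$, where $N_{G_M}(u)$ is the set of neighbours of $u$; $\partial\mathcal{N}_{\theta}(M)=\mathcal{N}_{\theta}(M)\setminus\mathcal{N}_{\theta}^{\circ}(M)$;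 $\mathcal{E}_{\theta}^{\circ}(M)=\{uv\in E(G_M): u,v\in\mathcal{N}_{\theta}(M)\}$. A vector is nowhere-zero if all its coordinates are nonzero. Connection: for real symmetric $A\in\mathbb{R}^{n\times n}$, $B\in\mathbb{R}^{m\times m}$, indices $r\in[n]$, $s\in[m]$ and real $\omega\neq0$, the connection of $A$ and $B$ (at $r,s$ with weight $\omega$) is the $(n+m)\times(n+m)$ symmetric matrix $C$ with $C_{ij}=a_{ij}$ for $i,j\in[n]$, $C_{ij}=b_{(i-n)(j-n)}$ for $n<i,j\le n+m$, $C_{r,n+s}=C_{n+s,r}=\omega$, and all other entries $0$. Define $\mathfrak{Z}_{\theta}$ = set of real symmetric matrices $A$ (any size) with $G_A$ a tree and $m_A(\theta)=0$; $\mathfrak{Min}_{\theta}$ = set of real symmetric matrices $A$ with $G_A$ a tree and having a nowhere-zero $\theta$-eigenvector; $\mathfrak{Link}_{\theta}$ = set of all $1\times1$ real matrices $[a]$ (called linking vertices). An acyclic irreducible matrix is obtained by the construction if it is built by connecting (via repeated connections) finitely many chosen elements of $\mathfrak{Z}_{\theta}\cup\mathfrak{Min}_{\theta}\cup\mathfrak{Link}_{\theta}$ so that: (1) the resulting matrix is acyclic and irreducible; (2) no two chosen elements of $\mathfrak{Z}_{\theta}\cup\mathfrak{Min}_{\theta}$ are connected to each other; (3) every chosen element of $\mathfrak{Link}_{\theta}$ is connected to at least two chosen elements of $\mathfrak{Min}_{\theta}$. Then $\mathcal{A}_{\theta}$ is the set of all matrices $P(A_1\oplus\cdots\oplus A_k)P^{T}$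 with $P$ a permutation matrix, $k\in\mathbb{N}$, each $A_i$ obtained by the construction, and $\oplus$ the block-diagonal direct sum. *)

theory Defs
  imports "Jordan_Normal_Form.Char_Poly"
begin

section \<open>Simple graphs\<close>

text \<open>
  An edge is a two-element vertex set. The digraph library is not used: in a symmetric
  digraph the closed walk \<open>a, b, a\<close> counts as a cycle, so its notion of forest does not
  give the undirected one.
\<close>

record 'a ugraph =
  verts :: "'a set"
  edges :: "'a set set"

definition neighbours :: "'a ugraph \<Rightarrow> 'a \<Rightarrow> 'a set" where
  "neighbours G u = {v. {u, v} \<in> edges G}"

definition degree_in :: "'a ugraph \<Rightarrow> 'a \<Rightarrow> nat" where
  "degree_in G u = card {e \<in> edges G. u \<in> e}"

definition joined :: "'a ugraph \<Rightarrow> 'a rel" where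
  "joined G = {(u, v). u \<in> verts G \<and> v \<in> verts G \<and> (u, v) \<in> {(x, y). {x, y} \<in> edges G}\<^sup>*}"

definition components :: "'a ugraph \<Rightarrow> 'a set set" where
  "components G = verts G // joined G"

definition connected_graph :: "'a ugraph \<Rightarrow> bool" where
  "connected_graph G \<longleftrightarrow> verts G \<noteq> {} \<and> (\<forall>u\<in>verts G. \<forall>v\<in>verts G. (u, v) \<in> joined G)"

definition cycle :: "'a ugraph \<Rightarrow> 'a list \<Rightarrow> bool" where
  "cycle G p \<longleftrightarrow> 3 \<le> length p \<and> distinct p \<and> set p \<subseteq> verts G \<and>
     (\<forall>i<length p. {p ! i, p ! (Suc i mod length p)} \<in> edges G)"

definition forest :: "'a ugraph \<Rightarrow> bool" where
  "forest G \<longleftrightarrow> (\<nexists>p. cycle G p)"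

definition tree :: "'a ugraph \<Rightarrow> bool" where
  "tree G \<longleftrightarrow> connected_graph G \<and> forest G"

definition delete_verts :: "'a ugraph \<Rightarrow> 'a set \<Rightarrow> 'a ugraph" where
  "delete_verts G S = \<lparr>verts = verts G - S, edges = {e \<in> edges G. e \<inter> S = {}}\<rparr>"

section \<open>Symmetric matrices, their graphs and eigenvectors\<close>

definition symmetric_mat :: "real mat \<Rightarrow> bool" where
  "symmetric_mat M \<longleftrightarrow> square_mat M \<and> M\<^sup>T = M"

text \<open>Indices, hence vertices, run from \<open>0\<close> to \<open>n - 1\<close>.\<close>

definition graph_of :: "real mat \<Rightarrow> nat ugraph" where
  "graph_of M = \<lparr>verts = {..<dim_row M},
     edges = {{i, j} | i j. i < dim_row M \<and> j < dim_row M \<and> i \<noteq> j \<and> M $$ (i, j) \<noteq> 0}\<rparr>"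

definition acyclic_mat :: "real mat \<Rightarrow> bool" where
  "acyclic_mat M \<longleftrightarrow> forest (graph_of M)"

definition permutation_mat :: "nat \<Rightarrow> real mat \<Rightarrow> bool" where
  "permutation_mat n P \<longleftrightarrow>
     (\<exists>\<sigma>. \<sigma> permutes {..<n} \<and> P = mat n n (\<lambda>(i, j). if i = \<sigma> j then 1 else 0))"

text \<open>
  Reducible: permutation similar to a block upper triangular matrix with square diagonal blocks
  of positive size.
\<close>

definition reducible_mat :: "real mat \<Rightarrow> bool" where
  "reducible_mat M \<longleftrightarrow>
     (\<exists>P r s B C D. permutation_mat (dim_row M) P \<and> 0 < r \<and> 0 < s \<and> r + s = dim_row M \<and>
        B \<in> carrier_mat r r \<and> C \<in> carrier_mat r s \<and> D \<in> carrier_mat s s \<and>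
        P * M * P\<^sup>T = four_block_mat B C (0\<^sub>m s r) D)"

definition irreducible_mat :: "real mat \<Rightarrow> bool" where
  "irreducible_mat M \<longleftrightarrow> \<not> reducible_mat M"

definition eig_mult :: "real \<Rightarrow> real mat \<Rightarrow> nat" where
  "eig_mult \<theta> M = Polynomial.order \<theta> (char_poly M)"

text \<open>In contrast to \<^const>\<open>eigenvector\<close>, the zero vector is admitted.\<close>

definition eigvecs :: "real \<Rightarrow> real mat \<Rightarrow> real vec set" where
  "eigvecs \<theta> M = {x \<in> carrier_vec (dim_row M). M *\<^sub>v x = \<theta> \<cdot>\<^sub>v x}"

definition nowhere_zero :: "real vec \<Rightarrow> bool" where
  "nowhere_zero x \<longleftrightarrow> (\<forall>i<dim_vec x. x $ i \<noteq> 0)"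

definition nodal :: "real \<Rightarrow> real mat \<Rightarrow> nat set" where
  "nodal \<theta> M = {u \<in> verts (graph_of M). \<forall>x\<in>eigvecs \<theta> M. x $ u = 0}"

definition nodal_interior :: "real \<Rightarrow> real mat \<Rightarrow> nat set" where
  "nodal_interior \<theta> M = {u \<in> nodal \<theta> M. neighbours (graph_of M) u \<subseteq> nodal \<theta> M}"

definition nodal_boundary :: "real \<Rightarrow> real mat \<Rightarrow> nat set" where
  "nodal_boundary \<theta> M = nodal \<theta> M - nodal_interior \<theta> M"

definition nodal_edges :: "real \<Rightarrow> real mat \<Rightarrow> nat set set" where
  "nodal_edges \<theta> M = {e \<in> edges (graph_of M). e \<subseteq> nodal \<theta> M}"

section \<open>The construction\<close>

definition connection :: "real mat \<Rightarrow> real mat \<Rightarrow> nat \<Rightarrow> nat \<Rightarrow> real \<Rightarrow> real mat" where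
  "connection A B r s \<omega> =
     (let n = dim_row A; m = dim_row B in
      mat (n + m) (n + m) (\<lambda>(i, j).
        if i < n \<and> j < n then A $$ (i, j)
        else if n \<le> i \<and> n \<le> j then B $$ (i - n, j - n)
        else if (i = r \<and> j = n + s) \<or> (i = n + s \<and> j = r) then \<omega>
        else 0))"

definition Z_set :: "real \<Rightarrow> real mat set" where
  "Z_set \<theta> = {A. symmetric_mat A \<and> tree (graph_of A) \<and> eig_mult \<theta> A = 0}"

definition Min_set :: "real \<Rightarrow> real mat set" where
  "Min_set \<theta> = {A. symmetric_mat A \<and> tree (graph_of A) \<and> (\<exists>x\<in>eigvecs \<theta> A. nowhere_zero x)}"

definition Link_set :: "real mat set" where
  "Link_set = carrier_mat 1 1"

text \<open>
  Every \<open>1 \<times> 1\<close> matrix lies in \<^const>\<open>Link_set\<close> and also in one of the other two sets, so a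
  chosen element carries the role in which it was chosen.
\<close>

datatype role = Z_role | Min_role | Link_role

fun role_set :: "real \<Rightarrow> role \<Rightarrow> real mat set" where
  "role_set \<theta> Z_role = Z_set \<theta>"
| "role_set \<theta> Min_role = Min_set \<theta>"
| "role_set \<theta> Link_role = Link_set"

text \<open>\<open>assembled \<theta> ps C\<close>: \<open>C\<close> arises by repeated connections from the chosen elements \<open>ps\<close>.\<close>

inductive assembled :: "real \<Rightarrow> (role \<times> real mat) list \<Rightarrow> real mat \<Rightarrow> bool" for \<theta> where
  chosen: "A \<in> role_set \<theta> k \<Longrightarrow> assembled \<theta> [(k, A)] A"
| connect: "\<lbrakk>assembled \<theta> ps A; assembled \<theta> qs B; r < dim_row A; s < dim_row B; \<omega> \<noteq> 0\<rbrakk>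
    \<Longrightarrow> assembled \<theta> (ps @ qs) (connection A B r s \<omega>)"

text \<open>The rows of the assembled matrix occupied by the \<open>i\<close>-th chosen element.\<close>

definition block :: "(role \<times> real mat) list \<Rightarrow> nat \<Rightarrow> nat set" where
  "block ps i = {sum_list (map (dim_row \<circ> snd) (take i ps)) ..<
                 sum_list (map (dim_row \<circ> snd) (take (Suc i) ps))}"

text \<open>
  Nonzero entries outside the diagonal blocks come exactly from the weights of the connections,
  so two chosen elements are connected iff the block of \<open>C\<close> between them is nonzero.
\<close>

definition linked :: "(role \<times> real mat) list \<Rightarrow> real mat \<Rightarrow> nat \<Rightarrow> nat \<Rightarrow> bool" where
  "linked ps C i j \<longleftrightarrow> i \<noteq> j \<and> (\<exists>u\<in>block ps i. \<exists>v\<in>block ps j. C $$ (u, v) \<noteq> 0)"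

definition by_construction :: "real \<Rightarrow> real mat \<Rightarrow> bool" where
  "by_construction \<theta> C \<longleftrightarrow> (\<exists>ps. assembled \<theta> ps C \<and>
     acyclic_mat C \<and> irreducible_mat C \<and>
     (\<forall>i<length ps. \<forall>j<length ps.
        fst (ps ! i) \<in> {Z_role, Min_role} \<longrightarrow> fst (ps ! j) \<in> {Z_role, Min_role} \<longrightarrow>
        \<not> linked ps C i j) \<and>
     (\<forall>i<length ps. fst (ps ! i) = Link_role \<longrightarrow>
        2 \<le> card {j. j < length ps \<and> fst (ps ! j) = Min_role \<and> linked ps C i j}))"

text \<open>The empty list contributes just the \<open>0 \<times> 0\<close> matrix.\<close>

definition A_set :: "real \<Rightarrow> real mat set" where
  "A_set \<theta> = {P * diag_block_mat As * P\<^sup>T | P As.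
     permutation_mat (dim_row (diag_block_mat As)) P \<and> (\<forall>A\<in>set As. by_construction \<theta> A)}"

end

theory Submission
  imports Defs
begin

text \<open>
  Fix an eigenvector \<open>x\<close> that vanishes only on the nodal set. In a forest, cutting \<open>x\<close> off along an
  edge \<open>uw\<close> changes \<open>(A - \<theta>) x = 0\<close> only at \<open>u\<close> and \<open>w\<close>. Paired with an arbitrary vector this shows
  that on each component outside the nodal set eigenvectors are multiples of \<open>x\<close>; at a boundary
  vertex \<open>b\<close> it gives a vector mapped by \<open>A - \<theta>\<close> to a multiple of \<open>e\<^sub>b\<close> and vanishing on the nodal
  set. So the eigenspace has one parameter per component, cut down by independent equations, one
  per boundary vertex, which is (iii); (ii) follows by counting edges of forests. The same vectors
  extend an eigenvector of a component of the interior of the nodal set to one of \<open>A\<close>, so these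
  components are nonsingular at \<open>\<theta>\<close>, and the decomposition into components and boundary vertices is
  the one required in (i).
\<close>

section \<open>Forests\<close>

text \<open>For an eigenvector \<open>x\<close> cut off to the side of \<open>w\<close> of an edge
  \<open>uw\<close>, the two errors are \<open>m u w * x w\<close> at \<open>u\<close> and
  \<open>- m u w * x u\<close> at \<open>w\<close>. Paired with \<open>v\<close> they give
  \<open>m u w\<close> times \<open>v u * x w - v w * x u\<close>, so proportionality is tested on
  each edge separately. At a boundary vertex \<open>b = u\<close> the second error contains
  \<open>x b = 0\<close>, which is why only a multiple of a unit vector remains. Only the boundary
  equations couple different components: a non-nodal vertex sees its own component and zeros, an
  interior nodal vertex sees zeros alone. The parameter count concerns the kernel, whereas the
  multiplicity is the order of a root of the characteristic polynomial. The two agree by symmetry,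
  through a factorisation involving \<open>X - A\<close> instead of a diagonalisation. For (i),
  direct sums and connections depend on the order of the rows, so every piece is carried by a list
  of vertices, and a permutation finally restores the given order.\<close>

definition simple_graph :: "'a ugraph \<Rightarrow> bool" where
  "simple_graph G \<longleftrightarrow> finite (verts G) \<and>
     (\<forall>e\<in>edges G. \<exists>u\<in>verts G. \<exists>v\<in>verts G. u \<noteq> v \<and> e = {u, v})"

text \<open>Reachability depends on the edge set alone, so removing or inserting an edge is a set
  operation on the argument.\<close>

definition reach :: "'a set set \<Rightarrow> 'a rel" where
  "reach E = {(x, y). {x, y} \<in> E}\<^sup>*"

definition induced :: "'a ugraph \<Rightarrow> 'a set \<Rightarrow> 'a ugraph" where
  "induced G U = \<lparr>verts = U, edges = {e \<in> edges G. e \<subseteq> U}\<rparr>"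

lemma induced_sel [simp]:
  "verts (induced G U) = U" "edges (induced G U) = {e \<in> edges G. e \<subseteq> U}"
  by (simp_all add: induced_def)

lemma simple_graph_finite: "simple_graph G \<Longrightarrow> finite (verts G)"
  by (simp add: simple_graph_def)

lemma simple_graph_edge:
  "simple_graph G \<Longrightarrow> {u, v} \<in> edges G \<Longrightarrow> u \<in> verts G \<and> v \<in> verts G \<and> u \<noteq> v"
  unfolding simple_graph_def by (metis doubleton_eq_iff)

lemma simple_graph_finite_edges:
  assumes "simple_graph G" shows "finite (edges G)"
proof (rule finite_subset)
  show "edges G \<subseteq> Pow (verts G)" using assms unfolding simple_graph_def by fast
  show "finite (Pow (verts G))" using assms by (simp add: simple_graph_finite)
qed

lemma simple_graph_subgraph:
  assumes "simple_graph G" and "verts H \<subseteq> verts G" and "edges H \<subseteq> edges G"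
    and "\<And>e. e \<in> edges H \<Longrightarrow> e \<subseteq> verts H"
  shows "simple_graph H"
  unfolding simple_graph_def
proof (intro conjI ballI)
  show "finite (verts H)" using assms(1,2) finite_subset by (auto simp: simple_graph_def)
  fix e assume e: "e \<in> edges H"
  then obtain u v where uv: "u \<noteq> v" "e = {u, v}"
    using assms(1,3) unfolding simple_graph_def by blast
  then show "\<exists>u\<in>verts H. \<exists>v\<in>verts H. u \<noteq> v \<and> e = {u, v}"
    using assms(4)[OF e] by blast
qed

lemma simple_graph_induced:
  assumes "simple_graph G" and "U \<subseteq> verts G" shows "simple_graph (induced G U)"
  by (rule simple_graph_subgraph[OF assms(1)]) (use assms(2) in auto)

lemma forest_subgraph:
  assumes "forest G" and "verts H \<subseteq> verts G" and "edges H \<subseteq> edges G"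
  shows "forest H"
  using assms unfolding forest_def cycle_def by (meson subset_iff)

section \<open>Reachability and connected components\<close>

lemma reach_refl [simp]: "(u, u) \<in> reach E"
  by (simp add: reach_def)

lemma reach_sym: "(u, v) \<in> reach E \<Longrightarrow> (v, u) \<in> reach E"
proof -
  have "sym {(x, y). {x, y} \<in> E}" by (auto simp: sym_def insert_commute)
  then show "(u, v) \<in> reach E \<Longrightarrow> (v, u) \<in> reach E"
    unfolding reach_def by (meson sym_rtrancl symD)
qed

lemma reach_trans: "(u, v) \<in> reach E \<Longrightarrow> (v, w) \<in> reach E \<Longrightarrow> (u, w) \<in> reach E"
  by (simp add: reach_def)

lemma reach_step: "(u, v) \<in> reach E \<Longrightarrow> {v, w} \<in> E \<Longrightarrow> (u, w) \<in> reach E"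
  unfolding reach_def by (auto intro: rtrancl_into_rtrancl)

lemma reach_edge: "{v, w} \<in> E \<Longrightarrow> (v, w) \<in> reach E"
  by (rule reach_step[OF reach_refl])

lemma reach_mono: "(u, v) \<in> reach E \<Longrightarrow> E \<subseteq> E' \<Longrightarrow> (u, v) \<in> reach E'"
  unfolding reach_def by (erule rev_subsetD, rule rtrancl_mono) auto

lemma reach_induct [consumes 1, case_names base step]:
  assumes "(u, v) \<in> reach E" and "P u"
    and "\<And>x y. (u, x) \<in> reach E \<Longrightarrow> {x, y} \<in> E \<Longrightarrow> P x \<Longrightarrow> P y"
  shows "P v"
  using assms(1) unfolding reach_def
  by (induction rule: rtrancl_induct) (auto intro: assms(2) assms(3)[unfolded reach_def])

text \<open>This confines a walk to a component or to one side of a cut. Read contrapositively, it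
  yields an edge leaving \<open>C\<close> on any walk that ends outside \<open>C\<close>.\<close>

lemma reach_closed:
  assumes "(u, v) \<in> reach E" and "u \<in> C"
    and "\<And>x y. x \<in> C \<Longrightarrow> {x, y} \<in> E \<Longrightarrow> y \<in> C"
  shows "v \<in> C \<and> (u, v) \<in> reach {e \<in> E. e \<subseteq> C}"
  using assms(1)
proof (induction rule: reach_induct)
  case base then show ?case using assms(2) by simp
next
  case (step x y)
  then have "y \<in> C" using assms(3) by blast
  moreover have "{x, y} \<in> {e \<in> E. e \<subseteq> C}" using step \<open>y \<in> C\<close> by auto
  ultimately show ?case using step reach_step by fast
qed

lemma joined_iff:
  "(u, v) \<in> joined G \<longleftrightarrow> u \<in> verts G \<and> v \<in> verts G \<and> (u, v) \<in> reach (edges G)"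
  by (simp add: joined_def reach_def)

lemma equiv_joined: "equiv (verts G) (joined G)"
proof (rule equivI)
  show "joined G \<subseteq> verts G \<times> verts G" by (auto simp: joined_iff)
  show "refl_on (verts G) (joined G)" by (simp add: refl_on_def joined_iff)
  show "sym (joined G)" unfolding sym_def joined_iff by (blast dest: reach_sym)
  show "trans (joined G)" unfolding trans_def joined_iff by (blast dest: reach_trans)
qed

lemma connected_induced_iff:
  "connected_graph (induced G S) \<longleftrightarrow>
     S \<noteq> {} \<and> (\<forall>u\<in>S. \<forall>v\<in>S. (u, v) \<in> reach {e \<in> edges G. e \<subseteq> S})"
  by (auto simp: connected_graph_def joined_iff)

lemma Union_components: "\<Union> (components G) = verts G"
  unfolding components_def by (rule Union_quotient[OF equiv_joined])

lemma components_subset: "C \<in> components G \<Longrightarrow> C \<subseteq> verts G"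
  using Union_components by fastforce

lemma components_disjoint:
  "C \<in> components G \<Longrightarrow> D \<in> components G \<Longrightarrow> C = D \<or> C \<inter> D = {}"
  unfolding components_def by (rule quotient_disj[OF equiv_joined])

lemma finite_components: "simple_graph G \<Longrightarrow> finite (components G)"
  using finite_UnionD[of "components G"] simple_graph_finite[of G] by (simp add: Union_components)

lemma component_reach:
  assumes "C \<in> components G" and "u \<in> C" and "v \<in> verts G"
  shows "v \<in> C \<longleftrightarrow> (u, v) \<in> reach (edges G)"
proof -
  from assms(1) obtain w where w: "C = joined G `` {w}"
    unfolding components_def by (rule quotientE)
  then have "(w, u) \<in> joined G" using assms(2) by simp
  then have "C = joined G `` {u}" unfolding w by (rule equiv_class_eq[OF equiv_joined])
  then have "v \<in> C \<longleftrightarrow> (u, v) \<in> joined G" by simp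
  moreover have "u \<in> verts G" using components_subset[OF assms(1)] assms(2) by (rule subsetD)
  ultimately show ?thesis using assms(3) by (simp add: joined_iff)
qed

lemma component_edge_closed:
  assumes "simple_graph G" and "C \<in> components G" and "u \<in> C" and "{u, v} \<in> edges G"
  shows "v \<in> C"
  using component_reach[OF assms(2,3), of v] simple_graph_edge[OF assms(1,4)] reach_edge[OF assms(4)]
  by simp

lemma component_connected:
  assumes "simple_graph G" and "C \<in> components G"
  shows "connected_graph (induced G C)"
  unfolding connected_induced_iff
proof (intro conjI ballI)
  show "C \<noteq> {}"
    using in_quotient_imp_non_empty[OF equiv_joined] assms(2) unfolding components_def .
  fix u v assume uv: "u \<in> C" "v \<in> C"
  have "v \<in> verts G" using components_subset[OF assms(2)] uv(2) by (rule subsetD)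
  then have "(u, v) \<in> reach (edges G)"
    using component_reach[OF assms(2) uv(1)] uv(2) by simp
  from reach_closed[OF this uv(1)] show "(u, v) \<in> reach {e \<in> edges G. e \<subseteq> C}"
    using component_edge_closed[OF assms] by blast
qed

lemma connected_subset_component:
  assumes "connected_graph (induced G P)" and "P \<subseteq> verts G" and "C \<in> components G"
    and "P \<inter> C \<noteq> {}"
  shows "P \<subseteq> C"
proof
  fix v assume v: "v \<in> P"
  from assms(4) obtain u where u: "u \<in> P" "u \<in> C" by blast
  have "(u, v) \<in> reach {e \<in> edges G. e \<subseteq> P}"
    using assms(1) u v unfolding connected_induced_iff by blast
  then have "(u, v) \<in> reach (edges G)" by (rule reach_mono) auto
  then show "v \<in> C" using component_reach[OF assms(3) u(2), of v] v assms(2) by auto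
qed

lemma induced_induced: "C \<subseteq> U \<Longrightarrow> induced (induced G U) C = induced G C"
  by (auto simp: induced_def)

section \<open>Bridges and the number of components of a forest\<close>

lemma reach_path:
  assumes "(u, v) \<in> reach E"
  obtains p where "distinct p" and "p \<noteq> []" and "hd p = u" and "last p = v"
    and "successively (\<lambda>x y. {x, y} \<in> E) p"
proof -
  have "\<exists>p. distinct p \<and> p \<noteq> [] \<and> hd p = u \<and> last p = v \<and> successively (\<lambda>x y. {x, y} \<in> E) p"
    using assms
  proof (induction rule: reach_induct)
    case base
    show ?case by (rule exI[of _ "[u]"]) simp
  next
    case (step y z)
    then obtain p where p: "distinct p" "p \<noteq> []" "hd p = u" "last p = y"
      "successively (\<lambda>x y. {x, y} \<in> E) p" by blast
    show ?case
    proof (cases "z \<in> set p")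
      case True
      \<comment> \<open>The walk returns to a vertex of the path; the path is cut off there to keep
        its vertices distinct, as \<open>cycle\<close> demands.\<close>
      then obtain p1 p2 where p12: "p = p1 @ z # p2" by (meson split_list)
      show ?thesis
        using p unfolding p12
        by (intro exI[of _ "p1 @ [z]"])
          (auto simp: successively_append_iff hd_append split: if_splits)
    next
      case False
      then show ?thesis
        using p step
        by (intro exI[of _ "p @ [z]"]) (auto simp: successively_append_iff)
    qed
  qed
  then show thesis using that by blast
qed

text \<open>A path from \<open>u\<close> to \<open>v\<close> that avoids the edge closes up with it
  to a cycle. It has at least three vertices, since a path on two vertices would be the removed
  edge.\<close>

lemma forest_bridge:
  assumes "forest G" and "simple_graph G" and uv: "{u, v} \<in> edges G"
  shows "(u, v) \<notin> reach (edges G - {{u, v}})"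
proof
  assume "(u, v) \<in> reach (edges G - {{u, v}})"
  then obtain p where p: "distinct p" "p \<noteq> []" "hd p = u" "last p = v"
    and s: "successively (\<lambda>x y. {x, y} \<in> edges G - {{u, v}}) p" by (rule reach_path)
  have st: "{p ! i, p ! Suc i} \<in> edges G - {{u, v}}" if "Suc i < length p" for i
    using s that unfolding successively_conv_nth by blast
  have "u \<noteq> v" using simple_graph_edge[OF assms(2) uv] by blast
  have u0: "p ! 0 = u" using p by (simp add: hd_conv_nth)
  have vl: "p ! (length p - 1) = v" using p by (simp add: last_conv_nth)
  have "length p \<noteq> 0" using p by simp
  moreover have "length p \<noteq> 1" using u0 vl \<open>u \<noteq> v\<close> by auto
  moreover have "length p \<noteq> 2" using st[of 0] u0 vl by auto
  ultimately have len: "3 \<le> length p" by linarith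
  have e: "{p ! i, p ! (Suc i mod length p)} \<in> edges G" if "i < length p" for i
  proof (cases "Suc i = length p")
    case True
    then have "i = length p - 1" by simp
    then show ?thesis using True u0 vl uv by (simp add: insert_commute)
  next
    case False
    then show ?thesis using st[of i] that by simp
  qed
  have "set p \<subseteq> verts G"
  proof
    fix x assume "x \<in> set p"
    then obtain i where "i < length p" "p ! i = x" by (auto simp: in_set_conv_nth)
    then show "x \<in> verts G" using e[of i] simple_graph_edge[OF assms(2)] by blast
  qed
  then have "cycle G p" unfolding cycle_def using p len e by blast
  then show False using assms(1) unfolding forest_def by blast
qed

text \<open>The stretches of a walk before the first and after the last use of the new edge run in
  \<open>E\<close>; which ends of the edge they meet is left open.\<close>

lemma reach_insert_edge:
  assumes "(w, x) \<in> reach (insert {u, v} E)"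
  shows "(w, x) \<in> reach E \<or> ((w, u) \<in> reach E \<or> (w, v) \<in> reach E)
    \<and> ((u, x) \<in> reach E \<or> (v, x) \<in> reach E)"
  using assms
proof (induction rule: reach_induct)
  case base then show ?case by simp
next
  case (step x y)
  show ?case
  proof (cases "{x, y} = {u, v}")
    case True
    then have "x = u \<and> y = v \<or> x = v \<and> y = u" by (auto simp: doubleton_eq_iff)
    then show ?thesis using step(3) by auto
  next
    case False
    then have "{x, y} \<in> E" using step by blast
    then show ?thesis using step(3) reach_step by metis
  qed
qed

text \<open>Each edge of a forest, when added, merges two components.\<close>

lemma card_components_forest:
  assumes "forest G" and "simple_graph G"
  shows "card (components G) + card (edges G) = card (verts G)"
proof -
  have fin: "finite (verts G)" using assms(2) by (rule simple_graph_finite)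
  define H where "H E = \<lparr>verts = verts G, edges = E\<rparr>" for E
  have "card (components (H E)) + card E = card (verts G)" if "E \<subseteq> edges G" for E
    using finite_subset[OF that simple_graph_finite_edges[OF assms(2)]] that
  proof (induction E rule: finite_induct)
    case empty
    have "(u, v) \<in> reach ({} :: 'a set set) \<longleftrightarrow> u = v" for u v by (simp add: reach_def)
    then have "joined (H {}) = Id_on (verts G)" by (auto simp: joined_iff H_def)
    then have "components (H {}) = (\<lambda>u. {u}) ` verts G"
      unfolding components_def by (auto simp: quotient_def H_def)
    then show ?case by (simp add: card_image)
  next
    case (insert e E)
    have sub: "E \<subseteq> edges G" "e \<in> edges G" using insert by auto
    obtain u v where uv: "u \<in> verts G" "v \<in> verts G" "u \<noteq> v" "e = {u, v}"
      using sub(2) assms(2) unfolding simple_graph_def by blast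
    \<comment> \<open>An edge is a bridge of the whole forest, hence also separates its ends in
      every smaller edge set.\<close>
    have "(u, v) \<notin> reach (edges G - {{u, v}})"
      using forest_bridge[OF assms] sub(2) uv(4) by blast
    moreover have sub': "E \<subseteq> edges G - {{u, v}}" using insert uv by auto
    ultimately have sep: "(u, v) \<notin> reach E" using reach_mono[OF _ sub'] by iprover
    define C where "C w = joined (H E) `` {w}" for w
    define D where "D w = joined (H (insert e E)) `` {w}" for w
    have C: "x \<in> C w \<longleftrightarrow> w \<in> verts G \<and> x \<in> verts G \<and> (w, x) \<in> reach E" for x w
      by (simp add: C_def joined_iff H_def)
    have D: "x \<in> D w \<longleftrightarrow> w \<in> verts G \<and> x \<in> verts G \<and> (w, x) \<in> reach (insert e E)" for x w
      by (simp add: D_def joined_iff H_def)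
    have comC: "components (H E) = C ` verts G" and comD: "components (H (insert e E)) = D ` verts G"
      by (auto simp: components_def quotient_def C_def D_def H_def)
    have up: "(w, x) \<in> reach E \<Longrightarrow> (w, x) \<in> reach (insert e E)" for w x
      by (rule reach_mono) auto
    have euv: "(u, v) \<in> reach (insert e E)" by (rule reach_edge) (simp add: uv)
    \<comment> \<open>The classes of \<open>u\<close> and \<open>v\<close> fuse, all others survive
      unchanged.\<close>
    have D1: "D w = (if w \<in> C u \<union> C v then C u \<union> C v else C w)" if w: "w \<in> verts G" for w
    proof (cases "w \<in> C u \<union> C v")
      case True
      have "(w, u) \<in> reach (insert e E)" "(w, v) \<in> reach (insert e E)"
        using True up[of u w] up[of v w] reach_sym[of u w "insert e E"] reach_sym[of v w "insert e E"]
          reach_trans[OF _ euv, of w] reach_trans[OF _ reach_sym[OF euv], of w]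
        unfolding Un_iff C by blast+
      then have "x \<in> C u \<union> C v \<Longrightarrow> x \<in> D w" for x
        unfolding Un_iff C D using w reach_trans[OF _ up, of w u x]
          reach_trans[OF _ up, of w v x] by blast
      moreover have "x \<in> D w \<Longrightarrow> x \<in> C u \<union> C v" for x
        using reach_insert_edge[of w x u v E] True uv(1,2)
          reach_trans[of u w E x] reach_trans[of v w E x]
        unfolding Un_iff C D uv(4)[symmetric] by blast
      ultimately show ?thesis using True by auto
    next
      case False
      then have "(w, u) \<notin> reach E" "(w, v) \<notin> reach E"
        using w uv reach_sym[of w u E] reach_sym[of w v E] unfolding Un_iff C by blast+
      then have "x \<in> D w \<longleftrightarrow> x \<in> C w" for x
        unfolding C D using reach_insert_edge[of w x u v E] up[of w x] uv(4) by auto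
      then show ?thesis using False by auto
    qed
    have Ceq: "C w = C x" if "w \<in> C x" for w x
      using that unfolding set_eq_iff C by (meson reach_sym reach_trans)
    have self: "w \<in> verts G \<Longrightarrow> w \<in> C w" for w by (simp add: C)
    have ne: "C u \<noteq> C v" using sep self[OF uv(2)] C[of v u] by auto
    have Duv: "D ` verts G = insert (C u \<union> C v) (C ` verts G - {C u, C v})" (is "?L = ?R")
    proof (intro subset_antisym subsetI)
      fix X assume "X \<in> ?L"
      then obtain w where w: "w \<in> verts G" "X = D w" by blast
      show "X \<in> ?R"
      proof (cases "w \<in> C u \<union> C v")
        case False
        then have "C w \<noteq> C u" "C w \<noteq> C v" using self[OF w(1)] by auto
        then show ?thesis using D1[OF w(1)] w False by auto
      qed (use D1[OF w(1)] w in auto)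
    next
      fix X assume "X \<in> ?R"
      then consider "X = C u \<union> C v" | w where "w \<in> verts G" "X = C w" "C w \<noteq> C u" "C w \<noteq> C v" by auto
      then show "X \<in> ?L"
      proof cases
        case 1
        then show ?thesis using D1[OF uv(1)] self[OF uv(1)] uv(1) by auto
      next
        case 2
        then have "w \<notin> C u \<union> C v" using Ceq[of w u] Ceq[of w v] by auto
        then show ?thesis using D1[OF 2(1)] 2 by auto
      qed
    qed
    have "C u \<union> C v \<notin> C ` verts G"
    proof
      assume "C u \<union> C v \<in> C ` verts G"
      then obtain w where "w \<in> verts G" "C u \<union> C v = C w" by blast
      then have "u \<in> C w" "v \<in> C w" using self[OF uv(1)] self[OF uv(2)] by auto
      then have "C w = C u" "C w = C v" by (simp_all only: Ceq)
      then show False using ne by simp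
    qed
    then have "card (D ` verts G) = Suc (card (C ` verts G - {C u, C v}))"
      unfolding Duv using fin by simp
    \<comment> \<open>This subtraction on \<open>nat\<close> is exact because of the lower bound on
      \<open>card {C u, C v}\<close> that follows.\<close>
    also have "card (C ` verts G - {C u, C v}) = card (C ` verts G) - 2"
      using ne uv fin by (subst card_Diff_subset) auto
    finally have "card (D ` verts G) = Suc (card (C ` verts G) - 2)" .
    moreover have "card {C u, C v} \<le> card (C ` verts G)"
      by (rule card_mono) (use fin uv in auto)
    ultimately have "Suc (card (D ` verts G)) = card (C ` verts G)" using ne by simp
    then show ?case using insert comC comD by simp
  qed
  from this[of "edges G"] show ?thesis
    by (simp add: H_def components_def joined_def)
qed

section \<open>Kernels and the multiplicity of an eigenvalue\<close>

text \<open>Adding \<open>a\<close> times \<open>w\<close> to \<open>v\<close> makes a given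
  coordinate vanish for at most one \<open>a\<close>, unless both vanish there, and finitely many
  excluded values leave a real number over.\<close>

lemma finite_nonvanishing:
  fixes S :: "('a \<Rightarrow> real) set"
  assumes "finite U" and "S \<noteq> {}"
    and lin: "\<And>u v a. u \<in> S \<Longrightarrow> v \<in> S \<Longrightarrow> (\<lambda>i. u i + a * v i) \<in> S"
    and "\<And>i. i \<in> U \<Longrightarrow> \<exists>v\<in>S. v i \<noteq> 0"
  shows "\<exists>v\<in>S. \<forall>i\<in>U. v i \<noteq> 0"
  using assms(1,4)
proof (induction U rule: finite_induct)
  case empty then show ?case using assms(2) by auto
next
  case (insert u U)
  from insert.IH[OF insert.prems] obtain v where v: "v \<in> S" "\<forall>i\<in>U. v i \<noteq> 0" by auto
  from insert.prems[of u] obtain w where w: "w \<in> S" "w u \<noteq> 0" by auto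
  \<comment> \<open>Where \<open>w i = 0\<close> the quotient is \<open>0\<close> by convention,
    which merely excludes one further value.\<close>
  have "finite ((\<lambda>i. - v i / w i) ` insert u U)" using insert by simp
  then obtain a where a: "a \<notin> (\<lambda>i. - v i / w i) ` insert u U"
    using ex_new_if_finite[OF infinite_UNIV_char_0] by blast
  have "v i + a * w i \<noteq> 0" if "i \<in> insert u U" for i
  proof (cases "w i = 0")
    case True
    then show ?thesis using v w that by auto
  next
    case False
    have "a \<noteq> - v i / w i" using a that by blast
    then show ?thesis using False by (auto simp: field_simps)
  qed
  then show ?case using lin[OF v(1) w(1)] by (intro bexI[of _ "\<lambda>i. v i + a * w i"]) auto
qed

text \<open>
  Elimination: by duality each constraint is nonzero on the solutions of the previous ones, so it
  can be solved for one of the coordinates that are still free.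
\<close>

lemma free_coordinates_constraints:
  fixes S :: "('a \<Rightarrow> real) set" and \<phi> :: "'b \<Rightarrow> ('a \<Rightarrow> real) \<Rightarrow> real"
  assumes "finite B" and "finite Q"
    and lin: "\<And>u v a. u \<in> S \<Longrightarrow> v \<in> S \<Longrightarrow> (\<lambda>i. u i + a * v i) \<in> S"
    and "\<And>b u v a. b \<in> B \<Longrightarrow> u \<in> S \<Longrightarrow> v \<in> S \<Longrightarrow> \<phi> b (\<lambda>i. u i + a * v i) = \<phi> b u + a * \<phi> b v"
    and free: "\<And>f. \<exists>v\<in>S. \<forall>q\<in>Q. v q = f q"
    and uniq: "\<And>v. v \<in> S \<Longrightarrow> \<forall>q\<in>Q. v q = 0 \<Longrightarrow> v = (\<lambda>_. 0)"
    and "\<And>b. b \<in> B \<Longrightarrow> \<exists>c\<in>S. \<forall>b'\<in>B. \<phi> b' c = (if b' = b then 1 else 0)"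
  shows "\<exists>Q'\<subseteq>Q. card Q' + card B = card Q \<and>
    (\<forall>f. \<exists>v\<in>S. (\<forall>b\<in>B. \<phi> b v = 0) \<and> (\<forall>q\<in>Q'. v q = f q)) \<and>
    (\<forall>v\<in>S. (\<forall>b\<in>B. \<phi> b v = 0) \<longrightarrow> (\<forall>q\<in>Q'. v q = 0) \<longrightarrow> v = (\<lambda>_. 0))"
  using assms(1,4,7)
proof (induction B rule: finite_induct)
  case empty
  show ?case by (rule exI[of _ Q]) (use free uniq in auto)
next
  case (insert b B)
  have \<phi>: "\<phi> b' (\<lambda>i. u i + a * v i) = \<phi> b' u + a * \<phi> b' v"
    if "b' \<in> insert b B" "u \<in> S" "v \<in> S" for b' u v a
    using insert.prems(1) that .
  have "\<exists>c\<in>S. \<forall>b'\<in>B. \<phi> b' c = (if b' = b'' then 1 else 0)" if "b'' \<in> B" for b''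
    using insert.prems(2)[of b''] that by blast
  then obtain Q' where Q': "Q' \<subseteq> Q" "card Q' + card B = card Q"
    and f': "\<And>f. \<exists>v\<in>S. (\<forall>b\<in>B. \<phi> b v = 0) \<and> (\<forall>q\<in>Q'. v q = f q)"
    and u': "\<And>v. v \<in> S \<Longrightarrow> (\<forall>b\<in>B. \<phi> b v = 0) \<Longrightarrow> (\<forall>q\<in>Q'. v q = 0) \<Longrightarrow> v = (\<lambda>_. 0)"
    using insert.IH[OF insert.prems(1)] by auto
  define T where "T = {v \<in> S. \<forall>b\<in>B. \<phi> b v = 0}"
  have T: "(\<lambda>i. u i + a * v i) \<in> T" if "u \<in> T" "v \<in> T" for u v a
    using that lin[of u v a] \<phi>[of _ u v a] by (simp add: T_def)
  have \<phi>T: "\<phi> b (\<lambda>i. u i + a * v i) = \<phi> b u + a * \<phi> b v" if "u \<in> T" "v \<in> T" for u v a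
    using that \<phi>[of b u v a] by (simp add: T_def)
  have fT: "\<exists>v\<in>T. \<forall>q\<in>Q'. v q = f q" for f using f'[of f] by (auto simp: T_def)
  have uT: "v = (\<lambda>_. 0)" if "v \<in> T" "\<forall>q\<in>Q'. v q = 0" for v using that u'[of v] by (simp add: T_def)
  have \<phi>0: "\<phi> b (\<lambda>_. 0) = 0" if "(\<lambda>_. 0) \<in> T" using \<phi>T[OF that that, of 1] by simp
  obtain c where c: "c \<in> S" "\<forall>b'\<in>insert b B. \<phi> b' c = (if b' = b then 1 else 0)"
    using insert.prems(2)[of b] by auto
  have cT: "c \<in> T" "\<phi> b c = 1" using c insert.hyps by (auto simp: T_def)
  obtain s where s: "\<And>q. s q \<in> T" "\<And>q p. p \<in> Q' \<Longrightarrow> s q p = (if p = q then 1 else 0)"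
  proof -
    have "\<exists>v. v \<in> T \<and> (\<forall>p\<in>Q'. v p = (if p = q then 1 else 0))" for q
      using fT[of "\<lambda>p. if p = q then 1 else 0"] by blast
    then have "\<exists>s. \<forall>q. s q \<in> T \<and> (\<forall>p\<in>Q'. s q p = (if p = q then 1 else 0))"
      by (intro choice allI)
    then show thesis using that by blast
  qed
  have fQ': "finite Q'" using finite_subset[OF Q'(1) assms(2)] .
  \<comment> \<open>Otherwise the constraint vanishes on all of \<open>T\<close>: subtracting
    \<open>v q * s q\<close> clears one coordinate at a time without changing
    \<open>\<phi> b\<close>, until uniqueness leaves the zero vector. The dual vector
    \<open>c\<close> contradicts this.\<close>
  have "\<exists>q\<in>Q'. \<phi> b (s q) \<noteq> 0"
  proof (rule ccontr)
    assume "\<not> (\<exists>q\<in>Q'. \<phi> b (s q) \<noteq> 0)"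
    then have z: "\<forall>q\<in>Q'. \<phi> b (s q) = 0" by blast
    have "\<phi> b v = 0" if "finite R" "R \<subseteq> Q'" "v \<in> T" "\<forall>q\<in>Q' - R. v q = 0" for R v
      using that
    proof (induction R arbitrary: v rule: finite_induct)
      case empty
      then have "v = (\<lambda>_. 0)" using uT[of v] by simp
      then show ?case using \<phi>0 empty.prems(2) by simp
    next
      case (insert q R)
      let ?w = "\<lambda>i. v i + (- v q) * s q i"
      have "\<phi> b ?w = 0"
      proof (rule insert.IH)
        show "?w \<in> T" by (rule T[OF insert.prems(2) s(1)])
        show "\<forall>p\<in>Q' - R. ?w p = 0" using insert.prems(3) s(2) by auto
      qed (use insert.prems(1) in simp)
      then show ?case using \<phi>T[OF insert.prems(2) s(1), of "- v q" q] z insert.prems(1) by simp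
    qed
    from this[OF fQ' subset_refl cT(1)] show False using cT(2) by simp
  qed
  then obtain q where q: "q \<in> Q'" "\<phi> b (s q) \<noteq> 0" by blast
  show ?case
  proof (intro exI[of _ "Q' - {q}"] conjI allI ballI impI)
    show "Q' - {q} \<subseteq> Q" using Q' by blast
    show "card (Q' - {q}) + card (insert b B) = card Q"
      using Q'(2) q(1) fQ' insert.hyps card_gt_0_iff[of Q'] by auto
    fix f :: "'a \<Rightarrow> real"
    obtain v where v: "v \<in> T" "\<forall>p\<in>Q'. v p = f p" using fT by blast
    \<comment> \<open>Among the coordinates in \<open>Q'\<close> only \<open>q\<close> is altered,
      by the amount that satisfies the new constraint.\<close>
    let ?w = "\<lambda>i. v i + (- \<phi> b v / \<phi> b (s q)) * s q i"
    have "?w \<in> T" by (rule T[OF v(1) s(1)])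
    moreover have "\<phi> b ?w = 0" unfolding \<phi>T[OF v(1) s(1)[of q]] using q(2) by simp
    moreover have "\<forall>p\<in>Q' - {q}. ?w p = f p" using v(2) s(2) by auto
    ultimately show "\<exists>v\<in>S. (\<forall>b\<in>insert b B. \<phi> b v = 0) \<and> (\<forall>q\<in>Q' - {q}. v q = f q)"
      unfolding T_def by blast
  next
    fix v assume v: "v \<in> S" "\<forall>b\<in>insert b B. \<phi> b v = 0" "\<forall>p\<in>Q' - {q}. v p = 0"
    then have vT: "v \<in> T" by (simp add: T_def)
    \<comment> \<open>Uniqueness makes \<open>v\<close> equal to \<open>v q * s q\<close>; the new
      constraint then forces \<open>v q = 0\<close>.\<close>
    let ?w = "\<lambda>i. v i + (- v q) * s q i"
    have wT: "?w \<in> T" by (rule T[OF vT s(1)])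
    then have "?w = (\<lambda>_. 0)" by (rule uT) (use v(3) s(2) in auto)
    then have "\<phi> b ?w = 0" using wT \<phi>0 by simp
    then have "v q = 0" using \<phi>T[OF vT s(1)[of q], of "- v q"] v(2) q(2) by simp
    then have "\<forall>p\<in>Q'. v p = 0" using v(3) by blast
    then show "v = (\<lambda>_. 0)" by (rule uT[OF vT])
  qed
qed

section \<open>Algebraic multiplicity from free coordinates of the kernel\<close>

definition shifted :: "real mat \<Rightarrow> real \<Rightarrow> nat \<Rightarrow> nat \<Rightarrow> real" where
  "shifted A \<theta> i j = A $$ (i, j) - (if i = j then \<theta> else 0)"

text \<open>Self-adjointness. It serves once for the orthogonality of kernel and range, and once to
  move the shifted matrix from a cut-off eigenvector onto the vector paired with it.\<close>

lemma sum_symmetric_swap: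
  fixes m :: "nat \<Rightarrow> nat \<Rightarrow> real"
  assumes "\<And>i j. i < n \<Longrightarrow> j < n \<Longrightarrow> m i j = m j i"
  shows "(\<Sum>i<n. p i * (\<Sum>j<n. m i j * q j)) = (\<Sum>i<n. q i * (\<Sum>j<n. m i j * p j))"
proof -
  have "(\<Sum>i<n. p i * (\<Sum>j<n. m i j * q j)) = (\<Sum>i<n. \<Sum>j<n. q j * (m j i * p i))"
    unfolding sum_distrib_left by (intro sum.cong refl) (use assms in auto)
  also have "\<dots> = (\<Sum>j<n. \<Sum>i<n. q j * (m j i * p i))" by (rule sum.swap)
  finally show ?thesis by (simp add: sum_distrib_left)
qed

lemma det_nonzeroI:
  fixes M :: "real mat"
  assumes M: "M \<in> carrier_mat n n"
    and inj: "\<And>y. (\<And>i. i < n \<Longrightarrow> (\<Sum>j<n. M $$ (i, j) * y j) = 0) \<Longrightarrow> \<forall>i<n. y i = 0"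
  shows "det M \<noteq> 0"
proof
  assume "det M = 0"
  then obtain v where v: "v \<in> carrier_vec n" "v \<noteq> 0\<^sub>v n" "M *\<^sub>v v = 0\<^sub>v n"
    using det_0_iff_vec_prod_zero_field[OF M] by blast
  have "(\<Sum>j<n. M $$ (i, j) * v $ j) = 0" if "i < n" for i
  proof -
    have "(M *\<^sub>v v) $ i = (\<Sum>j<n. M $$ (i, j) * v $ j)"
      using that M v(1) by (simp add: scalar_prod_def atLeast0LessThan)
    then show ?thesis using v(3) that by simp
  qed
  from inj[OF this] have "v = 0\<^sub>v n" using v(1) by (intro eq_vecI) auto
  then show False using v(2) by blast
qed

text \<open>
  If \<open>W\<close> has the kernel vectors dual to \<open>J\<close> in the columns \<open>J\<close> and unit vectors elsewhere, then
  \<open>(X - A) W = W' D\<close> with \<open>D\<close> diagonal, carrying \<open>X - \<theta>\<close> at the positions in \<open>J\<close>. By symmetry the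
  range of \<open>A - \<theta>\<close> is orthogonal to its kernel, so \<open>W'\<close> is still invertible at \<open>\<theta>\<close>.
\<close>

lemma eig_mult_eq_card_free_coordinates:
  assumes A: "A \<in> carrier_mat n n"
    and sym: "\<And>i j. i < n \<Longrightarrow> j < n \<Longrightarrow> A $$ (i, j) = A $$ (j, i)"
    and J: "J \<subseteq> {..<n}"
    and ex: "\<And>f. \<exists>v. (\<forall>j\<in>J. v j = f j) \<and> (\<forall>i<n. (\<Sum>j<n. shifted A \<theta> i j * v j) = 0)"
    and un: "\<And>v. \<forall>j\<in>J. v j = 0 \<Longrightarrow> \<forall>i<n. (\<Sum>j<n. shifted A \<theta> i j * v j) = 0 \<Longrightarrow> \<forall>i<n. v i = 0"
  shows "eig_mult \<theta> A = card J"
proof -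
  let ?m = "shifted A \<theta>"
  have msym: "?m i j = ?m j i" if "i < n" "j < n" for i j
    using sym that by (simp add: shifted_def)
  obtain K where K1: "\<And>j i. i \<in> J \<Longrightarrow> K j i = (if i = j then 1 else 0)"
    and K2: "\<And>j i. i < n \<Longrightarrow> (\<Sum>k<n. ?m i k * K j k) = 0"
  proof -
    have "\<exists>v. (\<forall>i\<in>J. v i = (if i = j then 1 else 0)) \<and> (\<forall>i<n. (\<Sum>k<n. ?m i k * v k) = 0)" for j
      using ex[of "\<lambda>p. if p = j then 1 else 0"] .
    then have "\<exists>K. \<forall>j. (\<forall>i\<in>J. K j i = (if i = j then 1 else 0)) \<and>
        (\<forall>i<n. (\<Sum>k<n. ?m i k * K j k) = 0)"
      by (intro choice allI)
    then show thesis using that by blast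
  qed
  have AK: "(\<Sum>k<n. A $$ (i, k) * K j k) = \<theta> * K j i" if "i < n" for i j
  proof -
    have "(\<Sum>k<n. ?m i k * K j k) = (\<Sum>k<n. A $$ (i, k) * K j k - (if k = i then \<theta> * K j k else 0))"
      by (rule sum.cong) (auto simp: shifted_def algebra_simps)
    also have "\<dots> = (\<Sum>k<n. A $$ (i, k) * K j k) - \<theta> * K j i"
      using that by (simp add: sum_subtractf)
    finally show ?thesis using K2[OF that, of j] by simp
  qed
  \<comment> \<open>Since \<open>(X - A) K_j = (X - \<theta>) K_j\<close>, each column in
    \<open>J\<close> releases a factor \<open>X - \<theta>\<close>, collected in \<open>D\<close>;
    the other columns of \<open>W'\<close> are those of \<open>X - A\<close> itself.\<close>
  define W where "W = mat n n (\<lambda>(i, j). if j \<in> J then K j i else if i = j then 1 else (0::real))"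
  define W' where "W' = mat n n (\<lambda>(i, j). if j \<in> J then [:K j i:]
    else if i = j then [:- A $$ (i, j), 1:] else [:- A $$ (i, j):])"
  define D where "D = mat n n (\<lambda>(i, j). if i = j then if j \<in> J then [:- \<theta>, 1:] else 1 else (0::real poly))"
  have car: "W \<in> carrier_mat n n" "W' \<in> carrier_mat n n" "D \<in> carrier_mat n n"
    by (simp_all add: W_def W'_def D_def)
  interpret const: comm_ring_hom "\<lambda>a::real. [:a:]" by unfold_locales auto
  have ev: "comm_ring_hom (\<lambda>p. poly p \<theta>)" by unfold_locales auto
  have CM: "char_poly_matrix A \<in> carrier_mat n n" using A by simp
  have detW: "det W \<noteq> 0"
  proof (rule det_nonzeroI[OF car(1)])
    fix y assume y: "\<And>i. i < n \<Longrightarrow> (\<Sum>j<n. W $$ (i, j) * y j) = 0"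
    have yJ: "y i = 0" if "i \<in> J" for i
    proof -
      have "i < n" using that J by auto
      then have "(\<Sum>j<n. W $$ (i, j) * y j) = (\<Sum>j<n. if j = i then y j else 0)"
        by (intro sum.cong) (use that K1 in \<open>auto simp: W_def\<close>)
      then show ?thesis using y[OF \<open>i < n\<close>] \<open>i < n\<close> by simp
    qed
    have "y i = 0" if "i < n" for i
    proof -
      have "(\<Sum>j<n. W $$ (i, j) * y j) = (\<Sum>j<n. if j = i then y j else 0)"
        by (intro sum.cong) (use that yJ in \<open>auto simp: W_def\<close>)
      then show ?thesis using y[OF that] that by simp
    qed
    then show "\<forall>i<n. y i = 0" by simp
  qed
  have prod: "char_poly_matrix A * map_mat (\<lambda>a. [:a:]) W = W' * D"
  proof (rule eq_matI)
    fix i j assume "i < dim_row (W' * D)" "j < dim_col (W' * D)"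
    then have ij: "i < n" "j < n" using car by auto
    \<comment> \<open>The two products are compared entrywise as polynomial functions, which
      determine real polynomials.\<close>
    have l: "poly ((char_poly_matrix A * map_mat (\<lambda>a. [:a:]) W) $$ (i, j)) t =
        (\<Sum>k<n. ((if k = i then t else 0) - A $$ (i, k)) * W $$ (k, j))" for t
    proof -
      have "poly ((char_poly_matrix A * map_mat (\<lambda>a. [:a:]) W) $$ (i, j)) t =
        (\<Sum>k<n. poly (char_poly_matrix A $$ (i, k)) t * W $$ (k, j))"
        using ij car carrier_matD[OF CM] by (simp add: scalar_prod_def poly_sum atLeast0LessThan mult.commute)
      also have "\<dots> = (\<Sum>k<n. ((if k = i then t else 0) - A $$ (i, k)) * W $$ (k, j))"
        by (rule sum.cong) (use ij A in \<open>auto simp: char_poly_matrix_def\<close>)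
      finally show ?thesis .
    qed
    have "(W' * D) $$ (i, j) = (\<Sum>k<n. W' $$ (i, k) * D $$ (k, j))"
      using ij car by (simp add: scalar_prod_def atLeast0LessThan)
    also have "\<dots> = (\<Sum>k<n. if k = j then W' $$ (i, k) * D $$ (k, j) else 0)"
      by (rule sum.cong) (use ij in \<open>auto simp: D_def\<close>)
    also have "\<dots> = W' $$ (i, j) * D $$ (j, j)" using ij by simp
    finally have r: "(W' * D) $$ (i, j) = W' $$ (i, j) * D $$ (j, j)" .
    have "poly ((char_poly_matrix A * map_mat (\<lambda>a. [:a:]) W) $$ (i, j)) t =
        poly ((W' * D) $$ (i, j)) t" for t
    proof (cases "j \<in> J")
      case True
      have "(\<Sum>k<n. ((if k = i then t else 0) - A $$ (i, k)) * W $$ (k, j)) =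
          (\<Sum>k<n. (if k = i then t * K j k else 0) - A $$ (i, k) * K j k)"
        by (rule sum.cong) (use ij True in \<open>auto simp: W_def algebra_simps\<close>)
      also have "\<dots> = t * K j i - \<theta> * K j i" using ij AK by (simp add: sum_subtractf)
      finally show ?thesis unfolding l r using ij True by (simp add: W'_def D_def algebra_simps)
    next
      case False
      have "(\<Sum>k<n. ((if k = i then t else 0) - A $$ (i, k)) * W $$ (k, j)) =
          (\<Sum>k<n. if k = j then (if k = i then t else 0) - A $$ (i, k) else 0)"
        by (rule sum.cong) (use ij False in \<open>auto simp: W_def\<close>)
      also have "\<dots> = (if j = i then t else 0) - A $$ (i, j)" using ij by simp
      finally show ?thesis unfolding l r using ij False by (auto simp: W'_def D_def)
    qed
    then show "(char_poly_matrix A * map_mat (\<lambda>a. [:a:]) W) $$ (i, j) = (W' * D) $$ (i, j)"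
      by (intro iffD1[OF poly_eq_poly_eq_iff] ext)
  qed (use CM car in auto)
  have "det (char_poly_matrix A) * [:det W:] = det (char_poly_matrix A * map_mat (\<lambda>a. [:a:]) W)"
    using det_mult[OF CM, of "map_mat (\<lambda>a. [:a:]) W"] car(1) by simp
  also have "\<dots> = det W' * det D" unfolding prod by (rule det_mult) (rule car)+
  finally have "det (char_poly_matrix A) * [:det W:] = det W' * det D" .
  moreover have "det D = [:- \<theta>, 1:] ^ card J"
  proof -
    have "upper_triangular D" by (auto simp: upper_triangular_def D_def)
    then have "det D = (\<Prod>i\<in>{0..<n}. D $$ (i, i))"
      using car(3) by (simp add: det_upper_triangular prod_list_diag_prod)
    also have "\<dots> = (\<Prod>i\<in>{0..<n}. if i \<in> J then [:- \<theta>, 1:] else 1)"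
      by (rule prod.cong) (auto simp: D_def)
    also have "\<dots> = (\<Prod>i\<in>{0..<n} \<inter> J. [:- \<theta>, 1:])" by (rule prod.inter_restrict[symmetric]) simp
    also have "{0..<n} \<inter> J = J" using J by auto
    finally show ?thesis by simp
  qed
  ultimately have eq: "char_poly A * [:det W:] = det W' * [:- \<theta>, 1:] ^ card J"
    by (simp add: char_poly_def)
  have "poly (det W') \<theta> = det (map_mat (\<lambda>p. poly p \<theta>) W')" by (rule comm_ring_hom.hom_det[OF ev, symmetric])
  also have "\<dots> \<noteq> 0"
  proof (rule det_nonzeroI)
    show "map_mat (\<lambda>p. poly p \<theta>) W' \<in> carrier_mat n n" using car by simp
    fix y assume y: "\<And>i. i < n \<Longrightarrow> (\<Sum>j<n. map_mat (\<lambda>p. poly p \<theta>) W' $$ (i, j) * y j) = 0"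
    \<comment> \<open>For \<open>y\<close> in the kernel of \<open>W'\<close> evaluated at \<theta>,
      the part \<open>p\<close> coming from \<open>J\<close> is a kernel vector of
      \<open>A - \<theta>\<close> and also equals \<open>(A - \<theta>) q\<close> for the remaining
      part \<open>q\<close>. So \<open>p\<close> is orthogonal to itself and vanishes; then
      \<open>q\<close> is a kernel vector that is zero on \<open>J\<close>.\<close>
    define p where "p i = (\<Sum>j<n. if j \<in> J then y j * K j i else 0)" for i
    define q where "q j = (if j \<in> J then 0 else y j)" for j
    have pq: "p i = (\<Sum>j<n. ?m i j * q j)" if "i < n" for i
    proof -
      have "(\<Sum>j<n. map_mat (\<lambda>p. poly p \<theta>) W' $$ (i, j) * y j) =
          (\<Sum>j<n. (if j \<in> J then y j * K j i else 0) - ?m i j * q j)"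
        by (rule sum.cong) (use that in \<open>auto simp: W'_def q_def shifted_def algebra_simps\<close>)
      then show ?thesis using y[OF that] by (simp add: p_def sum_subtractf)
    qed
    have pker: "(\<Sum>j<n. ?m i j * p j) = 0" if "i < n" for i
    proof -
      have "(\<Sum>j<n. ?m i j * p j) = (\<Sum>j<n. \<Sum>k<n. if k \<in> J then y k * (?m i j * K k j) else 0)"
        unfolding p_def sum_distrib_left by (intro sum.cong refl) auto
      also have "\<dots> = (\<Sum>k<n. \<Sum>j<n. if k \<in> J then y k * (?m i j * K k j) else 0)"
        by (rule sum.swap)
      also have "\<dots> = (\<Sum>k<n. if k \<in> J then y k * (\<Sum>j<n. ?m i j * K k j) else 0)"
        by (rule sum.cong) (auto simp: sum_distrib_left)
      also have "\<dots> = 0" by (rule sum.neutral) (use K2[OF that] in auto)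
      finally show ?thesis .
    qed
    have "(\<Sum>i<n. p i * p i) = (\<Sum>i<n. p i * (\<Sum>j<n. ?m i j * q j))"
      by (rule sum.cong) (auto simp: pq)
    also have "\<dots> = (\<Sum>i<n. q i * (\<Sum>j<n. ?m i j * p j))"
      by (rule sum_symmetric_swap) (rule msym)
    also have "\<dots> = 0" using pker by simp
    finally have "\<forall>i\<in>{..<n}. p i * p i = 0" by (subst (asm) sum_nonneg_eq_0_iff) auto
    then have p0: "p i = 0" if "i < n" for i using that by auto
    have yJ: "y i = 0" if "i \<in> J" for i
    proof -
      have "i < n" using that J by auto
      have "p i = (\<Sum>j<n. if j = i then y j else 0)"
        unfolding p_def by (rule sum.cong) (use that K1 in auto)
      then show ?thesis using p0[OF \<open>i < n\<close>] \<open>i < n\<close> by simp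
    qed
    have "\<forall>i<n. q i = 0"
      by (rule un) (use pq p0 in \<open>auto simp: q_def\<close>)
    then show "\<forall>i<n. y i = 0" using yJ by (auto simp: q_def split: if_splits)
  qed
  finally have nz: "poly (det W') \<theta> \<noteq> 0" .
  then have "det W' \<noteq> 0" by auto
  have "order \<theta> (char_poly A * [:det W:]) = order \<theta> (char_poly A)"
    using detW order_smult[of "det W" \<theta> "char_poly A"] by (simp add: mult.commute)
  moreover have "order \<theta> (det W' * [:- \<theta>, 1:] ^ card J) = card J"
    using \<open>det W' \<noteq> 0\<close> nz order_power_n_n[of \<theta> "card J"] by (simp add: order_mult order_0I)
  ultimately show ?thesis unfolding eig_mult_def eq by simp
qed

section \<open>Eigenvectors of acyclic symmetric matrices\<close>

lemma graph_of_verts [simp]: "verts (graph_of M) = {..<dim_row M}"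
  by (simp add: graph_of_def)

lemma simple_graph_of: "simple_graph (graph_of M)"
  unfolding simple_graph_def graph_of_def by auto

locale forest_matrix =
  fixes A :: "real mat" and \<theta> :: real and n :: nat
  assumes carrier: "A \<in> carrier_mat n n"
    and symm: "symmetric_mat A"
    and acyc: "acyclic_mat A"
begin

abbreviation "G \<equiv> graph_of A"
abbreviation "E \<equiv> edges (graph_of A)"
abbreviation "m \<equiv> shifted A \<theta>"
abbreviation "N \<equiv> nodal \<theta> A"
abbreviation "N\<^sub>i \<equiv> nodal_interior \<theta> A"
abbreviation "N\<^sub>b \<equiv> nodal_boundary \<theta> A"

definition mv :: "(nat \<Rightarrow> real) \<Rightarrow> nat \<Rightarrow> real" where
  "mv v i = (\<Sum>j<n. m i j * v j)"

text \<open>Vectors are functions on all of \<open>nat\<close>. Here the coordinates from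
  \<open>n\<close> on are unconstrained, while \<open>relaxed\<close> fixes them to zero.\<close>

definition ker :: "(nat \<Rightarrow> real) set" where
  "ker = {v. \<forall>i<n. mv v i = 0}"

lemma dim [simp]: "dim_row A = n" "dim_col A = n"
  using carrier by auto

lemma entry_sym: "i < n \<Longrightarrow> j < n \<Longrightarrow> A $$ (i, j) = A $$ (j, i)"
  using symm carrier unfolding symmetric_mat_def by (metis carrier_matD index_transpose_mat(1))

lemma m_sym: "i < n \<Longrightarrow> j < n \<Longrightarrow> m i j = m j i"
  by (simp add: shifted_def entry_sym)

lemma edge_iff: "{u, v} \<in> E \<longleftrightarrow> u < n \<and> v < n \<and> u \<noteq> v \<and> A $$ (u, v) \<noteq> 0"
  unfolding graph_of_def using entry_sym by (auto simp: doubleton_eq_iff)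

lemma edge_m: "{u, v} \<in> E \<longleftrightarrow> u < n \<and> v < n \<and> u \<noteq> v \<and> m u v \<noteq> 0"
  by (auto simp: edge_iff shifted_def)

lemma simple: "simple_graph G"
  by (rule simple_graph_of)

lemma forest_G: "forest G"
  using acyc by (simp add: acyclic_mat_def)

lemma mv_lin: "mv (\<lambda>i. u i + a * v i) k = mv u k + a * mv v k"
  by (simp add: mv_def algebra_simps sum.distrib sum_distrib_left)

lemma mv_cong: "(\<And>j. j < n \<Longrightarrow> u j = v j) \<Longrightarrow> mv u i = mv v i"
  by (simp add: mv_def)

lemma mv_swap: "(\<Sum>i<n. u i * mv v i) = (\<Sum>i<n. v i * mv u i)"
  unfolding mv_def by (rule sum_symmetric_swap) (rule m_sym)

lemma mv_eq:
  assumes "i < n" shows "mv v i = (\<Sum>j<n. A $$ (i, j) * v j) - \<theta> * v i"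
proof -
  have "mv v i = (\<Sum>j<n. A $$ (i, j) * v j - (if j = i then \<theta> * v j else 0))"
    unfolding mv_def by (rule sum.cong) (auto simp: shifted_def algebra_simps)
  then show ?thesis using assms by (simp add: sum_subtractf)
qed

lemma mult_vec_index:
  assumes "x \<in> carrier_vec n" and "i < n"
  shows "(A *\<^sub>v x) $ i = (\<Sum>j<n. A $$ (i, j) * x $ j)"
  using assms carrier by (simp add: scalar_prod_def atLeast0LessThan)

lemma ker_eigvecs: "v \<in> ker \<Longrightarrow> vec n v \<in> eigvecs \<theta> A"
proof -
  assume v: "v \<in> ker"
  have "A *\<^sub>v vec n v = \<theta> \<cdot>\<^sub>v vec n v"
  proof (rule eq_vecI)
    fix i assume "i < dim_vec (\<theta> \<cdot>\<^sub>v vec n v)"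
    then have i: "i < n" by simp
    then have "mv v i = 0" using v by (simp add: ker_def)
    then show "(A *\<^sub>v vec n v) $ i = (\<theta> \<cdot>\<^sub>v vec n v) $ i"
      using i mv_eq[OF i, of v] mult_vec_index[of "vec n v" i] by simp
  qed simp
  then show ?thesis by (simp add: eigvecs_def)
qed

lemma eigvecs_ker: "x \<in> eigvecs \<theta> A \<Longrightarrow> (\<lambda>i. x $ i) \<in> ker"
proof -
  assume x: "x \<in> eigvecs \<theta> A"
  then have c: "x \<in> carrier_vec n" and e: "A *\<^sub>v x = \<theta> \<cdot>\<^sub>v x" by (auto simp: eigvecs_def)
  have "mv (\<lambda>i. x $ i) i = 0" if "i < n" for i
    using mv_eq[OF that, of "\<lambda>i. x $ i"] mult_vec_index[OF c that] e c that by simp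
  then show ?thesis by (simp add: ker_def)
qed

lemma nodal_iff: "u \<in> N \<longleftrightarrow> u < n \<and> (\<forall>v\<in>ker. v u = 0)"
proof -
  have "(\<forall>x\<in>eigvecs \<theta> A. x $ u = 0) \<longleftrightarrow> (\<forall>v\<in>ker. v u = 0)" if "u < n"
  proof
    assume l: "\<forall>x\<in>eigvecs \<theta> A. x $ u = 0"
    show "\<forall>v\<in>ker. v u = 0"
    proof
      fix v assume "v \<in> ker"
      then have "vec n v $ u = 0" using l ker_eigvecs by blast
      then show "v u = 0" using that by simp
    qed
  next
    assume "\<forall>v\<in>ker. v u = 0"
    then show "\<forall>x\<in>eigvecs \<theta> A. x $ u = 0" using eigvecs_ker by blast
  qed
  then show ?thesis by (auto simp: nodal_def)
qed

lemma ker_nodal: "v \<in> ker \<Longrightarrow> u \<in> N \<Longrightarrow> v u = 0"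
  by (simp add: nodal_iff)

lemma interior_iff: "u \<in> N\<^sub>i \<longleftrightarrow> u \<in> N \<and> (\<forall>v. {u, v} \<in> E \<longrightarrow> v \<in> N)"
  by (auto simp: nodal_interior_def neighbours_def)

lemma boundary_iff: "u \<in> N\<^sub>b \<longleftrightarrow> u \<in> N \<and> (\<exists>v. {u, v} \<in> E \<and> v \<notin> N)"
  by (auto simp: nodal_boundary_def interior_iff)

lemma nodal_lt: "u \<in> N \<Longrightarrow> u < n"
  by (simp add: nodal_iff)

text \<open>Each non-nodal vertex has its own witness in \<open>ker\<close>; a generic combination
  serves all of them at once. If every vertex is nodal, the vector vanishes below
  \<open>n\<close>.\<close>

definition generic :: "nat \<Rightarrow> real" where
  "generic = (SOME x. x \<in> ker \<and> (\<forall>u\<in>{..<n} - N. x u \<noteq> 0))"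

lemma generic: "generic \<in> ker" "u < n \<Longrightarrow> u \<notin> N \<Longrightarrow> generic u \<noteq> 0" "u \<in> N \<Longrightarrow> generic u = 0"
proof -
  have "\<exists>x\<in>ker. \<forall>u\<in>{..<n} - N. x u \<noteq> 0"
  proof (rule finite_nonvanishing)
    have "(\<lambda>_. 0) \<in> ker" by (simp add: ker_def mv_def)
    then show "ker \<noteq> {}" by blast
  qed (auto simp: ker_def mv_lin nodal_iff[unfolded ker_def])
  then have "\<exists>x. x \<in> ker \<and> (\<forall>u\<in>{..<n} - N. x u \<noteq> 0)" by blast
  from someI_ex[OF this] have g: "generic \<in> ker \<and> (\<forall>u\<in>{..<n} - N. generic u \<noteq> 0)"
    unfolding generic_def .
  then show "generic \<in> ker" "u < n \<Longrightarrow> u \<notin> N \<Longrightarrow> generic u \<noteq> 0" by auto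
  show "u \<in> N \<Longrightarrow> generic u = 0" using g ker_nodal by blast
qed

section \<open>Cutting an eigenvector at an edge\<close>

definition branch :: "nat \<Rightarrow> nat \<Rightarrow> nat set" where
  "branch u w = {i. (w, i) \<in> reach (E - {{u, w}})}"

lemma branch_lt:
  assumes "{u, w} \<in> E" and "i \<in> branch u w" shows "i < n"
proof -
  have "(w, i) \<in> reach (E - {{u, w}})" using assms(2) by (simp add: branch_def)
  then have "i \<in> {..<n} \<and> (w, i) \<in> reach {e \<in> E - {{u, w}}. e \<subseteq> {..<n}}"
    by (rule reach_closed) (use assms(1) in \<open>auto simp: edge_iff\<close>)
  then show ?thesis by simp
qed

text \<open>By the bridge property only the edge \<open>{u, w}\<close> crosses between the branch
  and its complement. The equation at \<open>w\<close> therefore loses the term of \<open>u\<close>,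
  the equation at \<open>u\<close> retains only the term of \<open>w\<close>, and every other
  equation keeps all of its terms or none.\<close>

lemma mv_branch:
  assumes e: "{u, w} \<in> E" and x: "x \<in> ker" and i: "i < n"
  shows "mv (\<lambda>j. if j \<in> branch u w then x j else 0) i =
    m u w * ((if i = u then x w else 0) - (if i = w then x u else 0))"
proof -
  let ?D = "branch u w"
  have w: "w \<in> ?D" by (simp add: branch_def)
  have "(u, w) \<notin> reach (E - {{u, w}})" by (rule forest_bridge[OF forest_G simple e])
  then have u: "u \<notin> ?D" using reach_sym[of w u] by (auto simp: branch_def)
  have uw: "u < n" "w < n" using e by (auto simp: edge_iff)
  have cross: "a = w \<and> b = u" if "a \<in> ?D" "b \<notin> ?D" "m a b \<noteq> 0" "a < n" "b < n" for a b
  proof -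
    have "a \<noteq> b" using that by blast
    then have ab: "{a, b} \<in> E" using that by (simp add: edge_m)
    have "{a, b} = {u, w}"
    proof (rule ccontr)
      assume "{a, b} \<noteq> {u, w}"
      then have "b \<in> ?D" using that(1) ab reach_step[of w a "E - {{u, w}}" b] by (simp add: branch_def)
      then show False using that by blast
    qed
    then show ?thesis using that u by (auto simp: doubleton_eq_iff)
  qed
  show ?thesis
  proof (cases "i \<in> ?D")
    case True
    have "mv (\<lambda>j. if j \<in> ?D then x j else 0) i =
        (\<Sum>j<n. m i j * x j - (if j = u then (if i = w then m w u * x u else 0) else 0))"
      unfolding mv_def
      by (rule sum.cong) (use True cross[OF True] i u in auto)
    also have "\<dots> = mv x i - (if i = w then m w u * x u else 0)"
      using uw by (simp add: sum_subtractf mv_def)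
    also have "mv x i = 0" using x i by (simp add: ker_def)
    finally show ?thesis using True u uw by (auto simp: m_sym)
  next
    case False
    have "mv (\<lambda>j. if j \<in> ?D then x j else 0) i =
        (\<Sum>j<n. if j = w then (if i = u then m u w * x w else 0) else 0)"
      unfolding mv_def
    proof (rule sum.cong)
      fix j assume "j \<in> {..<n}"
      then show "m i j * (if j \<in> ?D then x j else 0) =
          (if j = w then (if i = u then m u w * x w else 0) else 0)"
        using False cross[of j i] m_sym[of i j] i w by auto
    qed simp
    then show ?thesis using False w uw by auto
  qed
qed

text \<open>
  With the equations on the nodal boundary dropped, a vector is determined by arbitrary values at
  representatives of the components outside the nodal set.
\<close>

definition relaxed :: "(nat \<Rightarrow> real) set" where
  "relaxed = {v. (\<forall>u. u \<in> N \<or> n \<le> u \<longrightarrow> v u = 0) \<and> (\<forall>u<n. u \<notin> N\<^sub>b \<longrightarrow> mv v u = 0)}"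

text \<open>Below \<open>n\<close>, \<open>mv v\<close> is supported on the boundary, where the
  generic eigenvector vanishes, so pairing \<open>v\<close> with the image of the cut-off
  eigenvector gives zero. Only the two errors of the cut contribute to that pairing.\<close>

lemma relaxed_edge:
  assumes v: "v \<in> relaxed" and e: "{u, w} \<in> E"
  shows "v u * generic w = v w * generic u"
proof -
  let ?x = "\<lambda>j. if j \<in> branch u w then generic j else 0"
  have uw: "u < n" "w < n" "m u w \<noteq> 0" "u \<noteq> w" using e by (auto simp: edge_m)
  have "(\<Sum>i<n. v i * mv ?x i) = (\<Sum>i<n. ?x i * mv v i)" by (rule mv_swap)
  also have "\<dots> = 0"
  proof (rule sum.neutral, rule ballI)
    fix i assume "i \<in> {..<n}"
    then show "?x i * mv v i = 0"
      using v generic(3)[of i] by (cases "i \<in> N\<^sub>b") (auto simp: relaxed_def boundary_iff)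
  qed
  also have "(\<Sum>i<n. v i * mv ?x i) = (\<Sum>i<n. (if i = u then v i * (m u w * generic w) else 0)
      - (if i = w then v i * (m u w * generic u) else 0))"
    by (rule sum.cong) (auto simp: mv_branch[OF e generic(1)] algebra_simps)
  also have "\<dots> = m u w * (v u * generic w - v w * generic u)"
    using uw by (simp add: sum_subtractf algebra_simps)
  finally show ?thesis using uw by simp
qed

abbreviation "H \<equiv> induced G ({..<n} - N)"

lemma simple_H: "simple_graph H"
  by (rule simple_graph_induced[OF simple]) auto

text \<open>The ratio of \<open>v\<close> to the generic eigenvector is constant along walks outside
  the nodal set; at each intermediate vertex the nonzero value of \<open>generic\<close> is
  cancelled.\<close>

lemma relaxed_reach:
  assumes v: "v \<in> relaxed" and r: "(u, w) \<in> reach (edges H)" and u: "u \<in> {..<n} - N"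
  shows "v u * generic w = v w * generic u"
  using r
proof (induction rule: reach_induct)
  case base then show ?case by simp
next
  case (step y z)
  have e: "{y, z} \<in> E" "y < n" "y \<notin> N" using step(2) by (auto simp: edge_iff)
  have gy: "generic y \<noteq> 0" using generic(2) e by blast
  have "generic y * (v u * generic z) = (v u * generic y) * generic z" by simp
  also have "\<dots> = (v y * generic z) * generic u" using step(3) by simp
  also have "\<dots> = generic y * (v z * generic u)" using relaxed_edge[OF v e(1)] by simp
  finally have "generic y * (v u * generic z) = generic y * (v z * generic u)" .
  then show ?case using gy by simp
qed

section \<open>One parameter for each component outside the nodal set\<close>

definition cell :: "nat \<Rightarrow> nat set" where
  "cell u = joined H `` {u}"

text \<open>The choice depends on the set \<open>cell u\<close> only, so all vertices of a component
  share one representative.\<close>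

definition rep :: "nat \<Rightarrow> nat" where
  "rep u = (SOME w. w \<in> cell u)"

lemma cell_iff: "w \<in> cell u \<longleftrightarrow> u \<in> {..<n} - N \<and> w \<in> {..<n} - N \<and> (u, w) \<in> reach (edges H)"
  by (simp add: cell_def joined_iff)

lemma components_H: "components H = cell ` ({..<n} - N)"
  by (auto simp: components_def quotient_def cell_def)

lemma rep_in: "u \<in> {..<n} - N \<Longrightarrow> rep u \<in> cell u"
  unfolding rep_def by (rule someI[of _ u]) (simp add: cell_iff)

lemma cell_eq: "w \<in> cell u \<Longrightarrow> cell w = cell u"
  unfolding cell_def using equiv_class_eq[OF equiv_joined, of u w H] by simp

lemma rep_eq: "w \<in> cell u \<Longrightarrow> rep w = rep u"
  by (simp add: rep_def cell_eq)

lemma card_reps: "card (rep ` ({..<n} - N)) = card (components H)"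
proof -
  let ?V = "{..<n} - N"
  have "cell (rep u) = cell u" if "u \<in> ?V" for u
    using cell_eq[OF rep_in[OF that]] .
  then have im: "components H = cell ` rep ` ?V"
    unfolding components_H image_image by (intro image_cong) auto
  have "inj_on cell (rep ` ?V)"
  proof (rule inj_onI)
    fix x y assume "x \<in> rep ` ?V" "y \<in> rep ` ?V" and eq: "cell x = cell y"
    then obtain u v where uv: "u \<in> ?V" "x = rep u" "v \<in> ?V" "y = rep v" by blast
    have "rep x = x" "rep y = y" using rep_eq[OF rep_in] uv by auto
    then show "x = y" using eq by (simp add: rep_def)
  qed
  then show ?thesis unfolding im by (simp add: card_image)
qed

text \<open>The generic eigenvector is rescaled by a separate factor on each component. At a
  non-nodal vertex all nonzero terms of the equation carry the same factor; at an interior nodal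
  vertex every term is zero.\<close>

lemma relaxed_free:
  "\<exists>v\<in>relaxed. \<forall>q\<in>rep ` ({..<n} - N). v q = f q"
proof -
  define c where "c u = f (rep u) / generic (rep u)" for u
  define v where "v u = (if u \<in> {..<n} - N then c u * generic u else 0)" for u
  have cc: "c j = c i" if "i \<in> {..<n} - N" "j \<in> {..<n} - N" "{i, j} \<in> E" for i j
  proof -
    have "j \<in> cell i" using that by (auto simp: cell_iff intro: reach_edge)
    then show ?thesis using rep_eq by (simp add: c_def)
  qed
  have "mv v i = 0" if "i < n" "i \<notin> N\<^sub>b" for i
  proof (cases "i \<in> N")
    case True
    then have int: "i \<in> N\<^sub>i" using that by (simp add: nodal_boundary_def)
    have "m i j * v j = 0" if "j < n" for j
    proof (cases "j \<in> N")
      case False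
      then have "{i, j} \<notin> E" "i \<noteq> j" using int True by (auto simp: interior_iff)
      then show ?thesis using \<open>i < n\<close> that by (simp add: edge_m)
    qed (simp add: v_def)
    then show ?thesis unfolding mv_def by (intro sum.neutral) blast
  next
    case False
    have eq: "m i j * v j = c i * (m i j * generic j)" if jn: "j < n" for j
    proof (cases "j \<in> N")
      case True then show ?thesis by (simp add: v_def generic)
    next
      case j: False
      consider "i = j" | "m i j = 0" | "{i, j} \<in> E" using \<open>i < n\<close> jn by (auto simp: edge_m)
      then show ?thesis
        using cc[of i j] False j jn \<open>i < n\<close> by cases (auto simp: v_def)
    qed
    have "mv v i = c i * mv generic i"
      unfolding mv_def sum_distrib_left by (rule sum.cong) (use eq in auto)
    then show ?thesis using generic(1) that by (simp add: ker_def)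
  qed
  then have "v \<in> relaxed" by (auto simp: relaxed_def v_def)
  moreover have "v q = f q" if q: "q \<in> rep ` ({..<n} - N)" for q
  proof -
    from q obtain u where u: "u \<in> {..<n} - N" "q = rep u" by blast
    then have "rep q = q" "q \<in> {..<n} - N"
      using rep_in[OF u(1)] rep_eq[OF rep_in[OF u(1)]] by (auto simp: cell_iff)
    then show ?thesis using generic(2)[of q] by (simp add: v_def c_def)
  qed
  ultimately show ?thesis by blast
qed

lemma relaxed_unique:
  assumes v: "v \<in> relaxed" and z: "\<forall>q\<in>rep ` ({..<n} - N). v q = 0"
  shows "v = (\<lambda>_. 0)"
proof
  fix u show "v u = 0"
  proof (cases "u \<in> {..<n} - N")
    case True
    have "(u, rep u) \<in> reach (edges H)" "rep u \<in> {..<n} - N"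
      using rep_in[OF True] by (auto simp: cell_iff)
    moreover have "v (rep u) = 0" using z True by blast
    ultimately show ?thesis using relaxed_reach[OF v _ True, of "rep u"] generic(2)[of "rep u"] by simp
  next
    case False
    then show ?thesis using v by (auto simp: relaxed_def)
  qed
qed

text \<open>The cut is made at an edge from \<open>b\<close> to a non-nodal \<open>t\<close>. The
  error at \<open>t\<close> is a multiple of \<open>generic b = 0\<close>, and the one at
  \<open>b\<close> is nonzero, so it can be normalised.\<close>

lemma relaxed_dual:
  assumes "b \<in> N\<^sub>b"
  shows "\<exists>c\<in>relaxed. \<forall>i<n. mv c i = (if i = b then 1 else 0)"
proof -
  obtain t where t: "{b, t} \<in> E" "t \<notin> N" and b: "b \<in> N" using assms by (auto simp: boundary_iff)
  have tn: "t < n" "m b t \<noteq> 0" using t(1) by (auto simp: edge_m)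
  let ?x = "\<lambda>j. if j \<in> branch b t then generic j else 0"
  let ?a = "m b t * generic t"
  have a: "?a \<noteq> 0" using generic(2)[OF tn(1) t(2)] tn by simp
  have x: "mv ?x i = (if i = b then ?a else 0)" if "i < n" for i
    using mv_branch[OF t(1) generic(1) that] generic(3)[OF b] by auto
  \<comment> \<open>The summand \<open>0\<close> gives \<open>c\<close> the shape to which
    \<open>mv_lin\<close> applies.\<close>
  define c where "c j = 0 + (1 / ?a) * ?x j" for j
  have z: "mv (\<lambda>_. 0) i = 0" for i by (simp add: mv_def)
  have c: "mv c i = (if i = b then 1 else 0)" if "i < n" for i
    unfolding c_def mv_lin z x[OF that] using a by auto
  moreover have "c \<in> relaxed"
    unfolding relaxed_def
  proof (intro CollectI conjI allI impI)
    fix u assume "u \<in> N \<or> n \<le> u"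
    then show "c u = 0" using branch_lt[OF t(1), of u] generic(3)[of u] by (auto simp: c_def)
  next
    fix u assume "u < n" "u \<notin> N\<^sub>b"
    then show "mv c u = 0" using c[of u] assms by auto
  qed
  ultimately show ?thesis by blast
qed

text \<open>Restoring the boundary equations turns \<open>relaxed\<close> into the kernel, up to
  coordinates from \<open>n\<close> on. The vectors of \<open>relaxed_dual\<close> make these
  equations independent, so each of them consumes one representative.\<close>

lemma eig_mult_eq: "eig_mult \<theta> A + card N\<^sub>b = card (components H)"
proof -
  let ?R = "rep ` ({..<n} - N)"
  have fin: "finite N\<^sub>b"
    by (rule finite_subset[of _ "{..<n}"]) (auto simp: boundary_iff nodal_lt)
  have lin: "(\<lambda>i. u i + a * v i) \<in> relaxed" if "u \<in> relaxed" "v \<in> relaxed" for u v a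
    using that by (simp add: relaxed_def mv_lin)
  have "\<exists>Q\<subseteq>?R. card Q + card N\<^sub>b = card ?R \<and>
    (\<forall>f. \<exists>v\<in>relaxed. (\<forall>b\<in>N\<^sub>b. mv v b = 0) \<and> (\<forall>q\<in>Q. v q = f q)) \<and>
    (\<forall>v\<in>relaxed. (\<forall>b\<in>N\<^sub>b. mv v b = 0) \<longrightarrow> (\<forall>q\<in>Q. v q = 0) \<longrightarrow> v = (\<lambda>_. 0))"
  proof (rule free_coordinates_constraints[OF fin])
    show "\<exists>c\<in>relaxed. \<forall>b'\<in>N\<^sub>b. mv c b' = (if b' = b then 1 else 0)" if "b \<in> N\<^sub>b" for b
    proof -
      obtain c where c: "c \<in> relaxed" "\<forall>i<n. mv c i = (if i = b then 1 else 0)"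
        using relaxed_dual[OF \<open>b \<in> N\<^sub>b\<close>] by blast
      have "\<forall>b'\<in>N\<^sub>b. b' < n" by (simp add: boundary_iff nodal_lt)
      with c(2) have "\<forall>b'\<in>N\<^sub>b. mv c b' = (if b' = b then 1 else 0)" by blast
      with c(1) show ?thesis by blast
    qed
  qed (simp, erule (1) lin, rule mv_lin, rule relaxed_free, erule (1) relaxed_unique)
  then obtain Q where Q: "Q \<subseteq> ?R" "card Q + card N\<^sub>b = card ?R"
    and ex: "\<forall>f. \<exists>v\<in>relaxed. (\<forall>b\<in>N\<^sub>b. mv v b = 0) \<and> (\<forall>q\<in>Q. v q = f q)"
    and un: "\<forall>v\<in>relaxed. (\<forall>b\<in>N\<^sub>b. mv v b = 0) \<longrightarrow> (\<forall>q\<in>Q. v q = 0) \<longrightarrow> v = (\<lambda>_. 0)"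
    by (elim exE conjE) (rule that)
  have "eig_mult \<theta> A = card Q"
  proof (rule eig_mult_eq_card_free_coordinates[OF carrier entry_sym])
    show "Q \<subseteq> {..<n}"
    proof
      fix q assume "q \<in> Q"
      then obtain u where u: "u \<in> {..<n} - N" "q = rep u" using Q(1) by blast
      then show "q \<in> {..<n}" using rep_in[OF u(1)] by (simp add: cell_iff)
    qed
    fix f :: "nat \<Rightarrow> real"
    obtain v where v: "v \<in> relaxed" "\<forall>b\<in>N\<^sub>b. mv v b = 0" "\<forall>q\<in>Q. v q = f q"
      using spec[OF ex, of f] by blast
    then have "\<forall>i<n. (\<Sum>j<n. m i j * v j) = 0"
      unfolding mv_def[symmetric] by (auto simp: relaxed_def)
    then show "\<exists>v. (\<forall>j\<in>Q. v j = f j) \<and> (\<forall>i<n. (\<Sum>j<n. m i j * v j) = 0)"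
      using v(3) by blast
  next
    fix v :: "nat \<Rightarrow> real"
    assume v0: "\<forall>j\<in>Q. v j = 0" and "\<forall>i<n. (\<Sum>j<n. m i j * v j) = 0"
    then have v: "v \<in> ker" by (simp add: ker_def mv_def)
    \<comment> \<open>Elements of \<open>ker\<close> are arbitrary from \<open>n\<close> on and have
      to be truncated to lie in \<open>relaxed\<close>.\<close>
    define v' where "v' i = (if i < n then v i else 0)" for i
    have eq: "mv v' i = mv v i" for i by (rule mv_cong) (simp add: v'_def)
    have "v' \<in> relaxed"
      using v ker_nodal[OF v] by (auto simp: relaxed_def eq ker_def v'_def)
    moreover have "\<forall>b\<in>N\<^sub>b. mv v' b = 0" using v by (simp add: eq ker_def boundary_iff nodal_lt)
    ultimately have "v' = (\<lambda>_. 0)" using un v0 by (simp add: v'_def)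
    then have z: "v' i = 0" for i by (rule fun_cong)
    have "v i = 0" if "i < n" for i
      using that z[of i] by (simp add: v'_def)
    then show "\<forall>i<n. v i = 0" by blast
  qed
  then show ?thesis using Q(2) card_reps by simp
qed

text \<open>
  The error that a vector supported in the interior of the nodal set leaves at boundary vertices
  is compensated by branches of the generic eigenvector, which vanish on the nodal set.
\<close>

lemma interior_component_nonsingular:
  assumes K: "K \<in> components (induced G N\<^sub>i)"
    and supp: "\<And>j. j \<notin> K \<Longrightarrow> y j = 0" and eq: "\<And>i. i \<in> K \<Longrightarrow> mv y i = 0"
  shows "y i = 0"
proof (cases "i \<in> K")
  case False then show ?thesis by (rule supp)
next
  case True
  have KN: "K \<subseteq> N\<^sub>i" using components_subset[OF K] by simp
  have NiN: "N\<^sub>i \<subseteq> N" by (auto simp: interior_iff)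
  have sI: "simple_graph (induced G N\<^sub>i)"
    by (rule simple_graph_induced[OF simple]) (use NiN nodal_lt in auto)
  have "\<exists>c. c \<in> relaxed \<and> (b \<in> N\<^sub>b \<longrightarrow> (\<forall>i<n. mv c i = (if i = b then 1 else 0)))" for b
  proof (cases "b \<in> N\<^sub>b")
    case True then show ?thesis using relaxed_dual[of b] by blast
  next
    case False
    \<comment> \<open>A default off the boundary, which makes the choice of \<open>c\<close>
      total.\<close>
    have "(\<lambda>_. 0) \<in> relaxed" by (simp add: relaxed_def mv_def)
    then show ?thesis using False by blast
  qed
  then have "\<exists>c. \<forall>b. c b \<in> relaxed \<and> (b \<in> N\<^sub>b \<longrightarrow> (\<forall>i<n. mv (c b) i = (if i = b then 1 else 0)))"
    by (intro choice allI)
  then obtain c where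
    *: "\<forall>b. c b \<in> relaxed \<and> (b \<in> N\<^sub>b \<longrightarrow> (\<forall>i<n. mv (c b) i = (if i = b then 1 else 0)))" ..
  then have c: "\<And>b. c b \<in> relaxed"
    "\<And>b i. b \<in> N\<^sub>b \<Longrightarrow> i < n \<Longrightarrow> mv (c b) i = (if i = b then 1 else 0)" by simp_all
  have fin: "finite N\<^sub>b"
    by (rule finite_subset[of _ "{..<n}"]) (auto simp: boundary_iff nodal_lt)
  \<comment> \<open>\<open>mv (c b)\<close> is the unit vector at \<open>b\<close>, so the
    coefficients \<open>mv y b\<close> cancel precisely the boundary errors.\<close>
  define w where "w j = y j - (\<Sum>b\<in>N\<^sub>b. mv y b * c b j)" for j
  have mvw: "mv w i = mv y i - (\<Sum>b\<in>N\<^sub>b. mv y b * mv (c b) i)" for i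
  proof -
    have "mv w i = mv y i - (\<Sum>j<n. \<Sum>b\<in>N\<^sub>b. mv y b * (m i j * c b j))"
      unfolding w_def mv_def[of "\<lambda>j. y j - _ j"]
      by (simp add: mv_def[of y i] right_diff_distrib sum_subtractf sum_distrib_left ac_simps)
    also have "(\<Sum>j<n. \<Sum>b\<in>N\<^sub>b. mv y b * (m i j * c b j)) = (\<Sum>b\<in>N\<^sub>b. \<Sum>j<n. mv y b * (m i j * c b j))"
      by (rule sum.swap)
    finally show ?thesis by (simp add: mv_def[of "c _"] sum_distrib_left)
  qed
  have mvw': "mv w i = mv y i - (if i \<in> N\<^sub>b then mv y i else 0)" if "i < n" for i
  proof -
    have "(\<Sum>b\<in>N\<^sub>b. mv y b * mv (c b) i) = (\<Sum>b\<in>N\<^sub>b. if b = i then mv y b else 0)"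
      by (rule sum.cong) (use c(2) that in auto)
    then show ?thesis unfolding mvw using fin by simp
  qed
  \<comment> \<open>\<open>y\<close> errs at the boundary only: a neighbour of \<open>K\<close> is
    nodal because \<open>K\<close> is interior, and an interior neighbour belongs to
    \<open>K\<close> itself.\<close>
  have "mv y i = 0" if "i < n" "i \<notin> N\<^sub>b" for i
  proof (cases "i \<in> K")
    case True then show ?thesis by (rule eq)
  next
    case False
    have "m i j * y j = 0" if "j < n" for j
    proof (rule ccontr)
      assume "m i j * y j \<noteq> 0"
      then have j: "j \<in> K" "m i j \<noteq> 0" using supp by auto
      then have e: "{j, i} \<in> E" using False that \<open>i < n\<close> m_sym by (auto simp: edge_m)
      have jI: "j \<in> N\<^sub>i" using j KN by blast
      then have "i \<in> N" using e by (simp add: interior_iff)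
      then have "i \<in> N\<^sub>i" using \<open>i \<notin> N\<^sub>b\<close> by (simp add: nodal_boundary_def)
      then have "{j, i} \<in> edges (induced G N\<^sub>i)" using e jI by simp
      from component_edge_closed[OF sI K j(1) this] show False using False by blast
    qed
    then show ?thesis unfolding mv_def by (intro sum.neutral) blast
  qed
  then have "w \<in> ker" by (simp add: ker_def mvw')
  \<comment> \<open>As an eigenvector \<open>w\<close> vanishes at the nodal vertex
    \<open>i\<close>, and so does every \<open>c b\<close>; only \<open>y i\<close> is left.\<close>
  moreover have iN: "i \<in> N" using True KN NiN by blast
  ultimately have "w i = 0" by (rule ker_nodal)
  moreover have "c b i = 0" for b using c(1)[of b] iN by (simp add: relaxed_def)
  ultimately show ?thesis by (simp add: w_def)
qed

end

context forest_matrix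
begin

section \<open>Counting components\<close>

lemma boundary_lt: "b \<in> N\<^sub>b \<Longrightarrow> b < n"
  by (simp add: boundary_iff nodal_lt)

lemma finite_boundary: "finite N\<^sub>b"
  by (rule finite_subset[of _ "{..<n}"]) (auto simp: boundary_lt)

lemma nodal_split: "N = N\<^sub>i \<union> N\<^sub>b" "N\<^sub>i \<inter> N\<^sub>b = {}"
  by (auto simp: nodal_boundary_def interior_iff)

definition F :: "nat ugraph" where
  "F = \<lparr>verts = {..<n} - N\<^sub>i, edges = E - nodal_edges \<theta> A\<rparr>"

lemma edges_F: "{u, v} \<in> edges F \<longleftrightarrow> {u, v} \<in> E \<and> (u \<notin> N \<or> v \<notin> N)"
  by (auto simp: F_def nodal_edges_def)

lemma edge_cases:
  assumes "e \<in> E" obtains u v where "e = {u, v}" "u < n" "v < n" "u \<noteq> v"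
proof -
  obtain u v where "e = {u, v}" using assms simple unfolding simple_graph_def by blast
  with assms that show thesis by (auto simp: edge_iff)
qed

text \<open>No edge is left dangling: all edges at an interior vertex have both ends in the nodal
  set and are removed as well.\<close>

lemma edges_F_subset: "e \<in> edges F \<Longrightarrow> e \<subseteq> verts F"
proof -
  assume e: "e \<in> edges F"
  then have "e \<in> E" by (simp add: F_def)
  then obtain u v where uv: "e = {u, v}" "u < n" "v < n" by (rule edge_cases)
  then have "{u, v} \<in> E" "{v, u} \<in> E" "u \<notin> N \<or> v \<notin> N"
    using e edges_F[of u v] by (auto simp: insert_commute)
  then have "u \<notin> N\<^sub>i" "v \<notin> N\<^sub>i" by (auto simp: interior_iff)
  then show "e \<subseteq> verts F" using uv by (simp add: F_def)
qed

lemma delete_boundary: "delete_verts F N\<^sub>b = H"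
proof -
  have "{..<n} - N\<^sub>i - N\<^sub>b = {..<n} - N" using nodal_split by blast
  moreover have "{e \<in> E - nodal_edges \<theta> A. e \<inter> N\<^sub>b = {}} = {e \<in> E. e \<subseteq> {..<n} - N}" (is "?L = ?R")
  proof (intro subset_antisym subsetI)
    fix e assume e: "e \<in> ?L"
    then have "e \<subseteq> verts F" by (intro edges_F_subset) (simp add: F_def)
    then show "e \<in> ?R" using e nodal_split by (auto simp: F_def)
  next
    fix e assume e: "e \<in> ?R"
    then have "e \<in> E" by simp
    then obtain u v where "e = {u, v}" by (rule edge_cases)
    then show "e \<in> ?L" using e nodal_split by (auto simp: nodal_edges_def)
  qed
  ultimately show ?thesis by (simp add: delete_verts_def F_def induced_def)
qed

lemma simple_F: "simple_graph F"
  by (rule simple_graph_subgraph[OF simple _ _ edges_F_subset]) (auto simp: F_def)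

text \<open>An edge of \<open>F\<close> has at most one boundary end, since edges inside the nodal
  set are gone; the degree sum counts no edge twice.\<close>

lemma card_edges_F: "card (edges F) = card (edges H) + (\<Sum>b\<in>N\<^sub>b. degree_in F b)"
proof -
  have fin: "finite (edges F)" by (rule simple_graph_finite_edges[OF simple_F])
  let ?X = "\<lambda>b. {e \<in> edges F. b \<in> e}"
  have eH: "edges H = {e \<in> edges F. e \<inter> N\<^sub>b = {}}"
    unfolding delete_boundary[symmetric] by (simp add: delete_verts_def)
  have "edges F = edges H \<union> (\<Union>b\<in>N\<^sub>b. ?X b)" unfolding eH by blast
  moreover have "card (edges H \<union> (\<Union>b\<in>N\<^sub>b. ?X b)) = card (edges H) + card (\<Union>b\<in>N\<^sub>b. ?X b)"
    unfolding eH by (rule card_Un_disjoint) (use fin finite_boundary in auto)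
  moreover have "card (\<Union>b\<in>N\<^sub>b. ?X b) = (\<Sum>b\<in>N\<^sub>b. card (?X b))"
  proof (rule card_UN_disjoint[OF finite_boundary])
    show "\<forall>i\<in>N\<^sub>b. \<forall>j\<in>N\<^sub>b. i \<noteq> j \<longrightarrow> ?X i \<inter> ?X j = {}"
    proof (intro ballI impI)
      fix a b assume ab: "a \<in> N\<^sub>b" "b \<in> N\<^sub>b" "a \<noteq> b"
      have False if e: "e \<in> edges F" "a \<in> e" "b \<in> e" for e
      proof -
        have "e \<in> E" using e(1) by (simp add: F_def)
        then obtain u v where "e = {u, v}" by (rule edge_cases)
        then have "e = {a, b}" using e ab by auto
        then show False using e(1) ab edges_F nodal_split by auto
      qed
      then show "?X a \<inter> ?X b = {}" by blast
    qed
  qed (use fin in auto)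
  ultimately show ?thesis by (simp add: degree_in_def)
qed

lemma eig_mult_components:
  "int (eig_mult \<theta> A) = int (card (components (delete_verts F N\<^sub>b))) - int (card N\<^sub>b)"
  using eig_mult_eq by (simp add: delete_boundary)

text \<open>Write \<open>c\<close> for the number of components, \<open>k\<close> for the number of
  boundary vertices and \<open>d\<close> for their degree sum. Counting vertices minus edges in both
  forests gives \<open>c(F) = c(H) + k - d\<close>, hence
  \<open>c(F) + d - 2k = c(H) - k\<close>.\<close>

lemma eig_mult_degrees:
  "int (eig_mult \<theta> A) = int (card (components F)) + (\<Sum>u\<in>N\<^sub>b. int (degree_in F u) - 2)"
proof -
  have "card (components F) + card (edges F) = card (verts F)"
    by (rule card_components_forest[OF forest_subgraph[OF forest_G] simple_F]) (auto simp: F_def)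
  moreover have "card (components H) + card (edges H) = card (verts H)"
    by (rule card_components_forest[OF forest_subgraph[OF forest_G] simple_H]) auto
  moreover have "card (verts F) = card (verts H) + card N\<^sub>b"
  proof -
    have "verts F = verts H \<union> N\<^sub>b" "verts H \<inter> N\<^sub>b = {}"
      using nodal_split boundary_lt by (auto simp: F_def)
    then show ?thesis using finite_boundary by (simp add: card_Un_disjoint)
  qed
  moreover have "(\<Sum>u\<in>N\<^sub>b. int (degree_in F u) - 2) =
      int (\<Sum>b\<in>N\<^sub>b. degree_in F b) - 2 * int (card N\<^sub>b)"
    by (simp add: sum_subtractf)
  ultimately show ?thesis using eig_mult_eq card_edges_F by linarith
qed

end

section \<open>Principal submatrices\<close>

text \<open>Indexed by a list because the order of the vertices fixes the order of the rows.\<close>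

definition submat :: "real mat \<Rightarrow> nat list \<Rightarrow> real mat" where
  "submat M xs = mat (length xs) (length xs) (\<lambda>(i, j). M $$ (xs ! i, xs ! j))"

lemma submat_dim [simp]: "dim_row (submat M xs) = length xs" "dim_col (submat M xs) = length xs"
  by (simp_all add: submat_def)

lemma submat_carrier: "submat M xs \<in> carrier_mat (length xs) (length xs)"
  by (simp add: submat_def)

lemma submat_index [simp]:
  "i < length xs \<Longrightarrow> j < length xs \<Longrightarrow> submat M xs $$ (i, j) = M $$ (xs ! i, xs ! j)"
  by (simp add: submat_def)

lemma symmetric_mat_index:
  assumes "symmetric_mat M" and "i < dim_row M" and "j < dim_row M"
  shows "M $$ (i, j) = M $$ (j, i)"
proof -
  have d: "dim_col M = dim_row M" and t: "M\<^sup>T = M"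
    using assms(1) by (simp_all add: symmetric_mat_def)
  have "M\<^sup>T $$ (i, j) = M $$ (j, i)" using assms d by simp
  then show ?thesis by (simp add: t)
qed

lemma edges_graph_of:
  assumes "symmetric_mat M"
  shows "{u, v} \<in> edges (graph_of M) \<longleftrightarrow>
    u < dim_row M \<and> v < dim_row M \<and> u \<noteq> v \<and> M $$ (u, v) \<noteq> 0"
  unfolding graph_of_def using symmetric_mat_index[OF assms] by (auto simp: doubleton_eq_iff)

text \<open>Column \<open>j\<close> of \<open>P\<close> is the unit vector at
  \<open>\<sigma> j\<close>, so entries are read through the inverse permutation.\<close>

lemma permutation_conjugate:
  fixes P M :: "real mat"
  assumes \<sigma>: "\<sigma> permutes {..<n}" and P: "P = mat n n (\<lambda>(i, j). if i = \<sigma> j then 1 else 0)"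
    and M: "M \<in> carrier_mat n n"
  shows "P * M * P\<^sup>T = mat n n (\<lambda>(i, j). M $$ (inv_into UNIV \<sigma> i, inv_into UNIV \<sigma> j))"
proof -
  have inv: "i = \<sigma> j \<longleftrightarrow> j = inv_into UNIV \<sigma> i" for i j
    using permutes_inverses[OF \<sigma>] by metis
  have lt: "i < n \<Longrightarrow> inv_into UNIV \<sigma> i < n" for i
    using permutes_in_image[OF permutes_inv[OF \<sigma>], of i] by simp
  have Pc: "P \<in> carrier_mat n n" by (simp add: P)
  have PM: "P * M = mat n n (\<lambda>(i, j). M $$ (inv_into UNIV \<sigma> i, j))"
  proof (rule eq_matI)
    fix i j assume "i < dim_row (mat n n (\<lambda>(i, j). M $$ (inv_into UNIV \<sigma> i, j)))"
      "j < dim_col (mat n n (\<lambda>(i, j). M $$ (inv_into UNIV \<sigma> i, j)))"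
    then have ij: "i < n" "j < n" by auto
    have "(P * M) $$ (i, j) = (\<Sum>k<n. P $$ (i, k) * M $$ (k, j))"
      using ij Pc M by (simp add: scalar_prod_def atLeast0LessThan)
    also have "\<dots> = (\<Sum>k<n. if k = inv_into UNIV \<sigma> i then M $$ (k, j) else 0)"
      by (rule sum.cong) (use ij in \<open>auto simp: P inv\<close>)
    also have "\<dots> = M $$ (inv_into UNIV \<sigma> i, j)" using lt[OF ij(1)] by simp
    finally show "(P * M) $$ (i, j) = mat n n (\<lambda>(i, j). M $$ (inv_into UNIV \<sigma> i, j)) $$ (i, j)"
      using ij by simp
  qed (use Pc M in auto)
  show ?thesis
  proof (rule eq_matI)
    fix i j assume "i < dim_row (mat n n (\<lambda>(i, j). M $$ (inv_into UNIV \<sigma> i, inv_into UNIV \<sigma> j)))"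
      "j < dim_col (mat n n (\<lambda>(i, j). M $$ (inv_into UNIV \<sigma> i, inv_into UNIV \<sigma> j)))"
    then have ij: "i < n" "j < n" by auto
    have "(P * M * P\<^sup>T) $$ (i, j) = (\<Sum>k<n. (P * M) $$ (i, k) * P $$ (j, k))"
      using ij Pc M by (simp add: scalar_prod_def atLeast0LessThan del: assoc_mult_mat)
    also have "\<dots> = (\<Sum>k<n. if k = inv_into UNIV \<sigma> j then M $$ (inv_into UNIV \<sigma> i, k) else 0)"
      unfolding PM by (rule sum.cong) (use ij in \<open>auto simp: P inv\<close>)
    also have "\<dots> = M $$ (inv_into UNIV \<sigma> i, inv_into UNIV \<sigma> j)" using lt[OF ij(2)] by simp
    finally show "(P * M * P\<^sup>T) $$ (i, j) = mat n n (\<lambda>(i, j). M $$ (inv_into UNIV \<sigma> i, inv_into UNIV \<sigma> j)) $$ (i, j)"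
      using ij by simp
  qed (use Pc M in auto)
qed

text \<open>By symmetry the zero block yields a set of vertices with no edge to its complement. The
  indices \<open>0\<close> and \<open>r\<close> give one vertex on each side, and connectedness
  would join them.\<close>

lemma connected_imp_irreducible:
  assumes M: "symmetric_mat M" and con: "connected_graph (graph_of M)"
  shows "irreducible_mat M"
  unfolding irreducible_mat_def
proof
  let ?n = "dim_row M"
  have Mc: "M \<in> carrier_mat ?n ?n" using M by (auto simp: symmetric_mat_def)
  assume "reducible_mat M"
  then obtain P r s B C D where P: "permutation_mat ?n P" and rs: "0 < r" "0 < s" "r + s = ?n"
    and BCD: "B \<in> carrier_mat r r" "C \<in> carrier_mat r s" "D \<in> carrier_mat s s"
    and eq: "P * M * P\<^sup>T = four_block_mat B C (0\<^sub>m s r) D"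
    unfolding reducible_mat_def by blast
  obtain \<sigma> where \<sigma>: "\<sigma> permutes {..<?n}" and
    P: "P = mat ?n ?n (\<lambda>(i, j). if i = \<sigma> j then 1 else 0)"
    using P unfolding permutation_mat_def by blast
  have low: "M $$ (inv_into UNIV \<sigma> i, inv_into UNIV \<sigma> j) = 0" if "r \<le> i" "i < ?n" "j < r" for i j
  proof -
    have "(P * M * P\<^sup>T) $$ (i, j) = M $$ (inv_into UNIV \<sigma> i, inv_into UNIV \<sigma> j)"
      unfolding permutation_conjugate[OF \<sigma> P Mc] using that rs by simp
    moreover have "(P * M * P\<^sup>T) $$ (i, j) = 0" unfolding eq using that rs BCD by simp
    ultimately show ?thesis by simp
  qed
  have inv: "inv_into UNIV \<sigma> (\<sigma> i) = i" "\<sigma> (inv_into UNIV \<sigma> i) = i" for i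
    using permutes_inverses[OF \<sigma>] by auto
  have lt: "\<sigma> i < ?n \<longleftrightarrow> i < ?n" for i
    using permutes_in_image[OF \<sigma>, of i] by simp
  have "inv_into UNIV \<sigma> 0 < ?n" "inv_into UNIV \<sigma> r < ?n" using lt[of "inv_into UNIV \<sigma> _"] inv rs by auto
  then have "(inv_into UNIV \<sigma> 0, inv_into UNIV \<sigma> r) \<in> reach (edges (graph_of M))"
    using con by (simp add: connected_graph_def joined_iff)
  then have "inv_into UNIV \<sigma> r \<in> {u. \<sigma> u < r}
      \<and> (inv_into UNIV \<sigma> 0, inv_into UNIV \<sigma> r) \<in> reach {e \<in> edges (graph_of M). e \<subseteq> {u. \<sigma> u < r}}"
  proof (rule reach_closed)
    fix x y assume x: "x \<in> {u. \<sigma> u < r}" and e: "{x, y} \<in> edges (graph_of M)"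
    then have xy: "x < ?n" "y < ?n" "M $$ (x, y) \<noteq> 0" by (auto simp: edges_graph_of[OF M])
    show "y \<in> {u. \<sigma> u < r}"
    proof (rule ccontr)
      assume "y \<notin> {u. \<sigma> u < r}"
      then have "M $$ (inv_into UNIV \<sigma> (\<sigma> y), inv_into UNIV \<sigma> (\<sigma> x)) = 0" using low x lt xy by simp
      then show False using xy symmetric_mat_index[OF M, of x y] by (simp add: inv)
    qed
  qed (simp add: inv rs)
  then show False by (simp add: inv)
qed

lemma diag_block_mat_submat:
  assumes "sorted_wrt (\<lambda>xs ys. \<forall>u\<in>set xs. \<forall>v\<in>set ys. M $$ (u, v) = 0 \<and> M $$ (v, u) = 0) xss"
  shows "diag_block_mat (map (submat M) xss) = submat M (concat xss)"
  using assms
proof (induction xss)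
  case Nil
  show ?case by (rule eq_matI) auto
next
  case (Cons xs xss)
  let ?ys = "concat xss"
  have z: "M $$ (u, v) = 0 \<and> M $$ (v, u) = 0" if "u \<in> set xs" "v \<in> set ?ys" for u v
    using Cons.prems that by auto
  have "diag_block_mat (map (submat M) (xs # xss)) =
    four_block_mat (submat M xs) (0\<^sub>m (length xs) (length ?ys)) (0\<^sub>m (length ?ys) (length xs))
      (submat M ?ys)"
    using Cons by (simp add: Let_def)
  also have "\<dots> = submat M (xs @ ?ys)"
  proof (rule eq_matI)
    fix i j assume "i < dim_row (submat M (xs @ ?ys))" "j < dim_col (submat M (xs @ ?ys))"
    then have ij: "i < length xs + length ?ys" "j < length xs + length ?ys" by auto
    have in1: "k < length xs \<Longrightarrow> xs ! k \<in> set xs" for k by simp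
    have in2: "\<not> k < length xs \<Longrightarrow> k < length xs + length ?ys \<Longrightarrow> ?ys ! (k - length xs) \<in> set ?ys" for k
      by (rule nth_mem) linarith
    show "four_block_mat (submat M xs) (0\<^sub>m (length xs) (length ?ys)) (0\<^sub>m (length ?ys) (length xs))
      (submat M ?ys) $$ (i, j) = submat M (xs @ ?ys) $$ (i, j)"
      using ij z[OF in1 in2] by (auto simp: nth_append)
  qed auto
  finally show ?case by simp
qed

context forest_matrix
begin

lemma submat_symmetric:
  assumes "set xs \<subseteq> {..<n}" shows "symmetric_mat (submat A xs)"
  unfolding symmetric_mat_def
proof
  have lt: "i < length xs \<Longrightarrow> xs ! i < n" for i using subsetD[OF assms nth_mem[of i xs]] by simp
  show "(submat A xs)\<^sup>T = submat A xs"
    by (rule eq_matI) (auto simp: entry_sym lt)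
qed simp

lemma submat_edge:
  assumes "distinct xs" and "set xs \<subseteq> {..<n}"
  shows "{i, j} \<in> edges (graph_of (submat A xs)) \<longleftrightarrow>
    i < length xs \<and> j < length xs \<and> {xs ! i, xs ! j} \<in> E"
proof -
  have lt: "i < length xs \<Longrightarrow> xs ! i < n" for i using subsetD[OF assms(2) nth_mem[of i xs]] by simp
  show ?thesis
    using lt nth_eq_iff_index_eq[OF assms(1)]
    by (auto simp: edges_graph_of[OF submat_symmetric[OF assms(2)]] edge_iff)
qed

lemma submat_forest:
  assumes "distinct xs" and "set xs \<subseteq> {..<n}"
  shows "forest (graph_of (submat A xs))"
  unfolding forest_def
proof
  assume "\<exists>p. cycle (graph_of (submat A xs)) p"
  then obtain p where p: "3 \<le> length p" "distinct p" "set p \<subseteq> {..<length xs}"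
    and e: "\<And>i. i < length p \<Longrightarrow> {p ! i, p ! (Suc i mod length p)} \<in> edges (graph_of (submat A xs))"
    by (auto simp: cycle_def)
  have "Suc i mod length p < length p" for i by (rule mod_less_divisor) (use p in linarith)
  then have "{map ((!) xs) p ! i, map ((!) xs) p ! (Suc i mod length p)} \<in> E" if "i < length p" for i
    using e[OF that] that by (simp add: submat_edge[OF assms])
  moreover have "distinct (map ((!) xs) p)"
    using p assms(1) inj_on_nth[of xs "set p"] by (auto simp: distinct_map)
  moreover have "set (map ((!) xs) p) \<subseteq> {..<n}"
    using p(3) assms(2) by (auto intro: subsetD nth_mem)
  ultimately have "cycle G (map ((!) xs) p)"
    using p(1) by (simp add: cycle_def)
  then show False using forest_G by (auto simp: forest_def)
qed

lemma submat_connected: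
  assumes "distinct xs" and "set xs \<subseteq> {..<n}" and con: "connected_graph (induced G (set xs))"
  shows "connected_graph (graph_of (submat A xs))"
proof -
  have "(i, j) \<in> reach (edges (graph_of (submat A xs)))" if ij: "i < length xs" "j < length xs" for i j
  proof -
    have "(xs ! i, xs ! j) \<in> reach {e \<in> E. e \<subseteq> set xs}"
      using con ij by (auto simp: connected_induced_iff)
    \<comment> \<open>The induction follows the vertices of the walk, so its claim speaks of every
      position that holds the current vertex.\<close>
    then have "\<forall>k<length xs. xs ! k = xs ! j \<longrightarrow> (i, k) \<in> reach (edges (graph_of (submat A xs)))"
    proof (induction rule: reach_induct)
      case base
      show ?case using nth_eq_iff_index_eq[OF assms(1) _ ij(1)] by simp
    next
      case (step x y)
      have "x \<in> set xs" using step(2) by simp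
      then obtain l where l: "l < length xs" "xs ! l = x" by (auto simp: in_set_conv_nth)
      then have il: "(i, l) \<in> reach (edges (graph_of (submat A xs)))" using step(3) by blast
      show ?case
      proof (intro allI impI)
        fix k assume "k < length xs" "xs ! k = y"
        then have "{l, k} \<in> edges (graph_of (submat A xs))"
          using step(2) l by (simp add: submat_edge[OF assms(1,2)])
        then show "(i, k) \<in> reach (edges (graph_of (submat A xs)))" by (rule reach_step[OF il])
      qed
    qed
    then show ?thesis using ij by blast
  qed
  moreover have "xs \<noteq> []" using con by (auto simp: connected_induced_iff)
  ultimately show ?thesis by (auto simp: connected_graph_def joined_iff lessThan_empty_iff)
qed

text \<open>The condition on products covers both uses: an extension by zero off \<open>xs\<close>,
  and the generic eigenvector, which may be nonzero off \<open>xs\<close> but only where the entry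
  of \<open>A\<close> is zero.\<close>

lemma submat_mult_vec:
  assumes xs: "distinct xs" "set xs \<subseteq> {..<n}" and x: "x \<in> carrier_vec (length xs)"
    and i: "i < length xs" and y: "\<And>j. j < length xs \<Longrightarrow> y (xs ! j) = x $ j"
    and z: "\<And>k. k < n \<Longrightarrow> k \<notin> set xs \<Longrightarrow> A $$ (xs ! i, k) * y k = 0"
  shows "(submat A xs *\<^sub>v x) $ i = (\<Sum>k<n. A $$ (xs ! i, k) * y k)"
proof -
  have "(submat A xs *\<^sub>v x) $ i = (\<Sum>j<length xs. A $$ (xs ! i, xs ! j) * y (xs ! j))"
    using x i y by (simp add: scalar_prod_def atLeast0LessThan)
  also have "\<dots> = (\<Sum>k\<in>set xs. A $$ (xs ! i, k) * y k)"
    by (rule sum.reindex_bij_betw[OF bij_betw_nth]) (use xs in auto)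
  also have "\<dots> = (\<Sum>k<n. A $$ (xs ! i, k) * y k)"
    by (rule sum.mono_neutral_left) (use xs z in auto)
  finally show ?thesis .
qed

lemma submat_tree:
  assumes "distinct xs" and "set xs \<subseteq> {..<n}" and "connected_graph (induced G (set xs))"
  shows "symmetric_mat (submat A xs) \<and> tree (graph_of (submat A xs))"
  using submat_symmetric submat_forest submat_connected assms by (simp add: tree_def)

text \<open>Restricting the generic eigenvector loses nothing, since every neighbour outside the
  component is nodal and contributes zero.\<close>

lemma submat_Min:
  assumes xs: "distinct xs" and T: "set xs \<in> components H"
  shows "submat A xs \<in> Min_set \<theta>"
proof -
  have sub: "set xs \<subseteq> {..<n} - N" using components_subset[OF T] by simp
  then have lt: "set xs \<subseteq> {..<n}" by blast
  have con: "connected_graph (induced G (set xs))"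
    using component_connected[OF simple_H T] sub by (simp add: induced_induced)
  define x where "x = vec (length xs) (\<lambda>i. generic (xs ! i))"
  have xc: "x \<in> carrier_vec (length xs)" by (simp add: x_def)
  have "submat A xs *\<^sub>v x = \<theta> \<cdot>\<^sub>v x"
  proof (rule eq_vecI)
    fix i assume "i < dim_vec (\<theta> \<cdot>\<^sub>v x)"
    then have i: "i < length xs" by (simp add: x_def)
    then have iS: "xs ! i \<in> set xs" by simp
    then have il: "xs ! i < n" "xs ! i \<notin> N" using sub by auto
    have "(submat A xs *\<^sub>v x) $ i = (\<Sum>k<n. A $$ (xs ! i, k) * generic k)"
    proof (rule submat_mult_vec[OF xs lt xc i])
      fix k assume k: "k < n" "k \<notin> set xs"
      show "A $$ (xs ! i, k) * generic k = 0"
      proof (cases "k \<in> N")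
        case False
        have "{xs ! i, k} \<notin> edges H"
          using component_edge_closed[OF simple_H T iS] k by blast
        then have "{xs ! i, k} \<notin> E" using il k False by auto
        moreover have "xs ! i \<noteq> k" using iS k by blast
        ultimately show ?thesis using il k by (simp add: edge_iff)
      qed (simp add: generic)
    qed (simp add: x_def)
    also have "\<dots> = \<theta> * generic (xs ! i)"
      using mv_eq[OF il(1), of generic] generic(1) il by (simp add: ker_def)
    finally show "(submat A xs *\<^sub>v x) $ i = (\<theta> \<cdot>\<^sub>v x) $ i" using i by (simp add: x_def)
  qed (simp add: x_def)
  then have "x \<in> eigvecs \<theta> (submat A xs)" using xc by (simp add: eigvecs_def)
  moreover have "nowhere_zero x"
    unfolding nowhere_zero_def x_def
  proof (intro allI impI)
    fix i assume "i < dim_vec (vec (length xs) (\<lambda>i. generic (xs ! i)))"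
    then have i: "i < length xs" by simp
    then have "xs ! i \<in> {..<n} - N" using sub nth_mem[of i xs] by blast
    then show "vec (length xs) (\<lambda>i. generic (xs ! i)) $ i \<noteq> 0" using generic(2) i by simp
  qed
  ultimately show ?thesis using submat_tree[OF xs lt con] by (auto simp: Min_set_def)
qed

text \<open>An eigenvector of the submatrix, extended by zero, satisfies the equations at all
  vertices of the component, and is therefore zero.\<close>

lemma submat_Z:
  assumes xs: "distinct xs" and K: "set xs \<in> components (induced G N\<^sub>i)"
  shows "submat A xs \<in> Z_set \<theta>"
proof -
  have sub: "set xs \<subseteq> N\<^sub>i" using components_subset[OF K] by simp
  have Nn: "N\<^sub>i \<subseteq> {..<n}" by (auto simp: interior_iff nodal_lt)
  then have lt: "set xs \<subseteq> {..<n}" using sub by blast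
  have sI: "simple_graph (induced G N\<^sub>i)" by (rule simple_graph_induced[OF simple]) (use Nn in auto)
  have con: "connected_graph (induced G (set xs))"
    using component_connected[OF sI K] sub by (simp add: induced_induced)
  have "eig_mult \<theta> (submat A xs) = 0"
  proof (rule ccontr)
    assume "eig_mult \<theta> (submat A xs) \<noteq> 0"
    then have "poly (char_poly (submat A xs)) \<theta> = 0" by (simp add: eig_mult_def order_root)
    then have "eigenvalue (submat A xs) \<theta>"
      using eigenvalue_root_char_poly[OF submat_carrier] by blast
    then obtain x where x: "x \<in> carrier_vec (length xs)" "x \<noteq> 0\<^sub>v (length xs)"
      "submat A xs *\<^sub>v x = \<theta> \<cdot>\<^sub>v x"
      by (auto simp: eigenvalue_def eigenvector_def)
    define y where "y k = (if k \<in> set xs then x $ the_inv_into {..<length xs} ((!) xs) k else 0)" for k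
    have inj: "inj_on ((!) xs) {..<length xs}" using xs by (intro inj_on_nth) auto
    have y: "y (xs ! j) = x $ j" if "j < length xs" for j
      using that the_inv_into_f_f[OF inj, of j] by (simp add: y_def)
    have "y k = 0" for k
    proof (rule interior_component_nonsingular[OF K])
      show "j \<notin> set xs \<Longrightarrow> y j = 0" for j by (simp add: y_def)
      fix u assume "u \<in> set xs"
      then obtain i where i: "i < length xs" "u = xs ! i" by (auto simp: in_set_conv_nth)
      have "(submat A xs *\<^sub>v x) $ i = (\<Sum>k<n. A $$ (xs ! i, k) * y k)"
        by (rule submat_mult_vec[OF xs lt x(1) i(1) y]) (auto simp: y_def)
      then have "(\<Sum>k<n. A $$ (u, k) * y k) = \<theta> * y u" using x i y by simp
      moreover have "u < n" using \<open>u \<in> set xs\<close> lt by auto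
      ultimately show "mv y u = 0" by (simp add: mv_eq)
    qed
    then have "x = 0\<^sub>v (length xs)" using y x(1) by (intro eq_vecI) auto
    then show False using x(2) by blast
  qed
  then show ?thesis using submat_tree[OF xs lt con] by (simp add: Z_set_def)
qed

end

section \<open>The construction\<close>

lemma nth_concat_block:
  assumes "i < length xss"
  shows "(!) (concat xss) ` {sum_list (map length (take i xss)) ..<
    sum_list (map length (take (Suc i) xss))} = set (xss ! i)"
  using assms
proof (induction xss arbitrary: i)
  case Nil then show ?case by simp
next
  case (Cons xs xss)
  show ?case
  proof (cases i)
    case 0
    have "(!) (concat (xs # xss)) ` {0..<length xs} = (!) xs ` {0..<length xs}"
      by (rule image_cong) (auto simp: nth_append)
    then show ?thesis using 0 by (auto simp: set_conv_nth)
  next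
    case (Suc k)
    let ?a = "sum_list (map length (take k xss))" and ?b = "sum_list (map length (take (Suc k) xss))"
    have "(!) (concat (xs # xss)) ` {length xs + ?a..<length xs + ?b} =
        (!) (concat (xs # xss)) ` (\<lambda>l. length xs + l) ` {?a..<?b}"
      by (simp add: add.commute)
    also have "\<dots> = (!) (concat xss) ` {?a..<?b}"
      unfolding image_image by (rule image_cong) (auto simp: nth_append)
    also have "\<dots> = set (xss ! k)" using Cons Suc by simp
    finally show ?thesis using Suc by simp
  qed
qed

lemma block_bound:
  assumes "i < length xss" and "k < sum_list (map length (take (Suc i) xss))"
  shows "k < length (concat xss)"
proof -
  have "length (concat xss) = length (concat (take (Suc i) xss)) + length (concat (drop (Suc i) xss))"
    by (metis append_take_drop_id concat_append length_append)
  moreover have "length (concat (take (Suc i) xss)) = sum_list (map length (take (Suc i) xss))"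
    by (rule length_concat)
  ultimately show ?thesis using assms(2) by linarith
qed

text \<open>The role is a function of the vertex set, independent of the order in which its vertices
  are listed.\<close>

definition pieces :: "(nat set \<Rightarrow> role) \<Rightarrow> real mat \<Rightarrow> nat list list \<Rightarrow> (role \<times> real mat) list" where
  "pieces \<rho> M xss = map (\<lambda>xs. (\<rho> (set xs), submat M xs)) xss"

lemma pieces_append: "pieces \<rho> M (xss @ yss) = pieces \<rho> M xss @ pieces \<rho> M yss"
  by (simp add: pieces_def)

lemma length_pieces [simp]: "length (pieces \<rho> M xss) = length xss"
  by (simp add: pieces_def)

lemma fst_pieces [simp]: "i < length xss \<Longrightarrow> fst (pieces \<rho> M xss ! i) = \<rho> (set (xss ! i))"
  by (simp add: pieces_def)

lemma linked_pieces:
  assumes "i < length xss" and "j < length xss"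
  shows "linked (pieces \<rho> M xss) (submat M (concat xss)) i j \<longleftrightarrow>
    i \<noteq> j \<and> (\<exists>u\<in>set (xss ! i). \<exists>v\<in>set (xss ! j). M $$ (u, v) \<noteq> 0)"
proof -
  have dims: "map (dim_row \<circ> snd) (take k (pieces \<rho> M xss)) = map length (take k xss)" for k
    by (simp add: pieces_def take_map)
  let ?B = "\<lambda>k. {sum_list (map length (take k xss)) ..< sum_list (map length (take (Suc k) xss))}"
  have "(\<exists>u\<in>?B i. \<exists>v\<in>?B j. submat M (concat xss) $$ (u, v) \<noteq> 0) \<longleftrightarrow>
      (\<exists>u\<in>?B i. \<exists>v\<in>?B j. M $$ (concat xss ! u, concat xss ! v) \<noteq> 0)"
    by (intro bex_cong refl) (use assms in \<open>simp add: block_bound\<close>)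
  also have "\<dots> \<longleftrightarrow> (\<exists>u\<in>(!) (concat xss) ` ?B i. \<exists>v\<in>(!) (concat xss) ` ?B j. M $$ (u, v) \<noteq> 0)"
    by blast
  also have "\<dots> \<longleftrightarrow> (\<exists>u\<in>set (xss ! i). \<exists>v\<in>set (xss ! j). M $$ (u, v) \<noteq> 0)"
    by (simp only: nth_concat_block[OF assms(1)] nth_concat_block[OF assms(2)])
  finally show ?thesis by (simp add: linked_def block_def dims)
qed

lemma distinct_concat_nth_disjoint:
  assumes "distinct (concat xss)" and "i < length xss" and "j < length xss" and "i \<noteq> j"
  shows "set (xss ! i) \<inter> set (xss ! j) = {}"
proof -
  have *: "set (xss ! i) \<inter> set (xss ! j) = {}"
    if "distinct (concat xss)" "i < j" "j < length xss" for i j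
    using that
  proof (induction xss arbitrary: i j)
    case (Cons xs xss)
    obtain l where l: "j = Suc l" "l < length xss" using Cons.prems by (cases j) auto
    show ?case
    proof (cases i)
      case 0
      have "set (xss ! l) \<subseteq> set (concat xss)" using nth_mem[OF l(2)] by auto
      then show ?thesis using Cons.prems(1) 0 l by auto
    next
      case (Suc k)
      then show ?thesis using Cons.IH[of k l] Cons.prems l by simp
    qed
  qed simp
  show ?thesis
    using *[of i j] *[of j i] assms by (cases "i < j") (auto simp: Int_commute)
qed

section \<open>Assembling a connected vertex set from connected parts\<close>

context forest_matrix
begin

lemma connection_submat:
  assumes xs: "distinct xs" and ys: "distinct ys" and sub: "set xs \<subseteq> {..<n}" "set ys \<subseteq> {..<n}"
    and dis: "set xs \<inter> set ys = {}"
    and r: "r < length xs" and s: "s < length ys"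
    and cross: "\<And>x y. x \<in> set xs \<Longrightarrow> y \<in> set ys \<Longrightarrow> {x, y} \<in> E \<Longrightarrow> x = xs ! r \<and> y = ys ! s"
  shows "connection (submat A xs) (submat A ys) r s (A $$ (xs ! r, ys ! s)) = submat A (xs @ ys)"
proof (rule eq_matI)
  let ?p = "length xs" and ?q = "length ys"
  fix i j assume "i < dim_row (submat A (xs @ ys))" "j < dim_col (submat A (xs @ ys))"
  then have ij: "i < ?p + ?q" "j < ?p + ?q" by auto
  have zero: "A $$ (xs ! a, ys ! b) = 0 \<and> A $$ (ys ! b, xs ! a) = 0"
    if "a < ?p" "b < ?q" "\<not> (a = r \<and> b = s)" for a b
  proof -
    have m: "xs ! a \<in> set xs" "ys ! b \<in> set ys" using that by auto
    have "{xs ! a, ys ! b} \<notin> E"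
    proof
      assume "{xs ! a, ys ! b} \<in> E"
      then have "xs ! a = xs ! r \<and> ys ! b = ys ! s" by (rule cross[OF m])
      then have "a = r \<and> b = s" using that r s xs ys by (simp add: nth_eq_iff_index_eq)
      then show False using that by blast
    qed
    moreover have "xs ! a < n" "ys ! b < n" "xs ! a \<noteq> ys ! b" using m sub dis by auto
    ultimately show ?thesis by (simp add: edge_iff entry_sym[of "ys ! b"])
  qed
  have "xs ! r < n" "ys ! s < n" using sub r s nth_mem by (auto dest!: subsetD)
  then have rs: "A $$ (ys ! s, xs ! r) = A $$ (xs ! r, ys ! s)" by (simp add: entry_sym)
  show "connection (submat A xs) (submat A ys) r s (A $$ (xs ! r, ys ! s)) $$ (i, j) =
      submat A (xs @ ys) $$ (i, j)"
  proof (cases "i < ?p"; cases "j < ?p")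
    assume a: "i < ?p" "\<not> j < ?p"
    then have "j = ?p + (j - ?p)" by simp
    then obtain b where b: "j = ?p + b" ..
    show ?thesis
      using a(1) ij zero[of i b] unfolding b by (auto simp: connection_def Let_def nth_append)
  next
    assume a: "\<not> i < ?p" "j < ?p"
    then have "i = ?p + (i - ?p)" by simp
    then obtain b where b: "i = ?p + b" ..
    show ?thesis
      using a(2) ij zero[of j b] rs unfolding b by (auto simp: connection_def Let_def nth_append)
  qed (use ij in \<open>auto simp: connection_def Let_def nth_append\<close>)
qed (simp_all add: connection_def Let_def)

text \<open>
  Removing an edge between two parts splits a connected set into two connected sets, each a union
  of parts, and conversely the two principal submatrices are joined by a connection.
\<close>

lemma assembled_partition:
  assumes "finite \<P>" and "connected_graph (induced G S)" and "S \<subseteq> {..<n}" and "\<Union>\<P> = S"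
    and "\<And>P Q. P \<in> \<P> \<Longrightarrow> Q \<in> \<P> \<Longrightarrow> P = Q \<or> P \<inter> Q = {}"
    and "\<And>P. P \<in> \<P> \<Longrightarrow> connected_graph (induced G P)"
    and "\<And>xs. distinct xs \<Longrightarrow> set xs \<in> \<P> \<Longrightarrow> submat A xs \<in> role_set \<theta> (\<rho> (set xs))"
  shows "\<exists>xss. distinct (concat xss) \<and> set ` set xss = \<P> \<and>
    assembled \<theta> (pieces \<rho> A xss) (submat A (concat xss))"
  using assms
proof (induction "card \<P>" arbitrary: \<P> S rule: less_induct)
  case less
  have S0: "S \<noteq> {}" using less.prems(2) by (simp add: connected_induced_iff)
  then obtain P where P: "P \<in> \<P>" using less.prems(4) by auto
  have ne: "Q \<noteq> {}" if "Q \<in> \<P>" for Q using less.prems(6)[OF that] by (simp add: connected_induced_iff)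
  have PS: "Q \<subseteq> S" if "Q \<in> \<P>" for Q using less.prems(4) that by blast
  show ?case
  proof (cases "\<P> = {P}")
    case True
    have "finite P" by (rule finite_subset[of P "{..<n}"]) (use PS[OF P] less.prems(3) in auto)
    then obtain xs where xs: "set xs = P" "distinct xs" using finite_distinct_list by blast
    then have "submat A xs \<in> role_set \<theta> (\<rho> (set xs))" using less.prems(7) P by blast
    then have "assembled \<theta> (pieces \<rho> A [xs]) (submat A (concat [xs]))"
      unfolding pieces_def by (simp add: chosen)
    then show ?thesis using xs True by (intro exI[of _ "[xs]"]) simp
  next
    case False
    then obtain Q where Q: "Q \<in> \<P>" "Q \<noteq> P" using P by blast
    obtain u v where uv: "u \<in> P" "v \<in> Q" using ne[OF P] ne[OF Q(1)] by blast
    have "v \<notin> P" using less.prems(5)[OF P Q(1)] Q(2) uv by blast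
    have "(u, v) \<in> reach {e \<in> E. e \<subseteq> S}"
      using less.prems(2) subsetD[OF PS[OF P] uv(1)] subsetD[OF PS[OF Q(1)] uv(2)]
      by (simp add: connected_induced_iff)
    \<comment> \<open>A walk from \<open>u\<close> to \<open>v\<close> has to leave
      \<open>P\<close>. Cutting at an edge that leaves a part, not at an arbitrary edge, keeps every
      part whole.\<close>
    then have "\<exists>r s. r \<in> P \<and> s \<notin> P \<and> {r, s} \<in> {e \<in> E. e \<subseteq> S}"
      using reach_closed[of u v "{e \<in> E. e \<subseteq> S}" P] uv(1) \<open>v \<notin> P\<close> by blast
    then obtain r s where rs: "r \<in> P" "s \<notin> P" "{r, s} \<in> E" "r \<in> S" "s \<in> S" by auto
    define E' where "E' = {e \<in> E. e \<subseteq> S} - {{r, s}}"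
    define S1 where "S1 = {w \<in> S. (r, w) \<in> reach E'}"
    define S2 where "S2 = S - S1"
    have "(r, s) \<notin> reach (E - {{r, s}})" by (rule forest_bridge[OF forest_G simple rs(3)])
    moreover have "E' \<subseteq> E - {{r, s}}" by (auto simp: E'_def)
    ultimately have nrs: "(r, s) \<notin> reach E'" using reach_mono[of r s E' "E - {{r, s}}"] by blast
    have r1: "r \<in> S1" and s2: "s \<in> S2" using rs nrs by (auto simp: S1_def S2_def)
    have S12: "S1 \<inter> S2 = {}" "S1 \<union> S2 = S" by (auto simp: S1_def S2_def)
    have stepS1: "y \<in> S1" if "x \<in> S1" "{x, y} \<in> E'" for x y
      using that reach_step[of r x E' y] by (auto simp: S1_def E'_def)
    have stepS2: "y \<in> S2" if "x \<in> S2" "{x, y} \<in> E'" for x y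
    proof (rule ccontr)
      assume "y \<notin> S2"
      then have "y \<in> S1" using that by (auto simp: S2_def E'_def)
      then have "x \<in> S1" using stepS1[of y x] that by (simp add: insert_commute)
      then show False using that S12 by blast
    qed
    have cross: "x = r \<and> y = s" if "x \<in> S1" "y \<in> S2" "{x, y} \<in> E" for x y
    proof -
      have "{x, y} = {r, s}"
      proof (rule ccontr)
        assume "{x, y} \<noteq> {r, s}"
        then have "{x, y} \<in> E'" using that S12 by (auto simp: E'_def)
        then show False using stepS1[OF that(1)] that(2) S12 by blast
      qed
      then show ?thesis using that r1 s2 S12 by (auto simp: doubleton_eq_iff)
    qed
    have ins: "{e \<in> E. e \<subseteq> S} = insert {r, s} E'" using rs by (auto simp: E'_def)
    \<comment> \<open>Whatever \<open>r\<close> no longer reaches without the bridge is reached from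
      \<open>s\<close>, so there are exactly two sides.\<close>
    have s_reach: "(s, w) \<in> reach E'" if "w \<in> S2" for w
    proof -
      have "(r, w) \<in> reach {e \<in> E. e \<subseteq> S}"
        using less.prems(2) rs that by (auto simp: connected_induced_iff S2_def)
      then have "(r, w) \<in> reach E' \<or> (s, w) \<in> reach E'"
        unfolding ins using reach_insert_edge[of r w r s E'] by blast
      then show ?thesis using that by (auto simp: S1_def S2_def)
    qed
    have con: "connected_graph (induced G S')"
      if "t \<in> S'" "S' \<subseteq> S" "\<And>w. w \<in> S' \<Longrightarrow> (t, w) \<in> reach E'"
        "\<And>x y. x \<in> S' \<Longrightarrow> {x, y} \<in> E' \<Longrightarrow> y \<in> S'" for t S'
      unfolding connected_induced_iff
    proof (intro conjI ballI)
      show "S' \<noteq> {}" using that(1) by blast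
      fix x y assume xy: "x \<in> S'" "y \<in> S'"
      have "(x, y) \<in> reach E'" by (rule reach_trans[OF reach_sym[OF that(3)[OF xy(1)]] that(3)[OF xy(2)]])
      then have "(x, y) \<in> reach {e \<in> E'. e \<subseteq> S'}" using reach_closed[OF _ xy(1) that(4)] by simp
      then show "(x, y) \<in> reach {e \<in> E. e \<subseteq> S'}" by (rule reach_mono) (auto simp: E'_def)
    qed
    have con1: "connected_graph (induced G S1)"
      by (rule con[OF r1 _ _ stepS1]) (auto simp: S1_def)
    have con2: "connected_graph (induced G S2)"
      by (rule con[OF s2 _ s_reach stepS2]) (auto simp: S2_def)
    \<comment> \<open>No edge inside a part is \<open>{r, s}\<close>: the part containing
      \<open>r\<close> is \<open>P\<close>, and \<open>s\<close> lies outside it. Connected parts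
      thus stay on one side.\<close>
    have part: "Q \<subseteq> S1 \<or> Q \<subseteq> S2" if "Q \<in> \<P>" for Q
    proof -
      have "\<not> {r, s} \<subseteq> Q" using less.prems(5)[OF that P] rs by blast
      then have QE: "{e \<in> E. e \<subseteq> Q} \<subseteq> E'" using PS[OF that] by (auto simp: E'_def)
      have "w \<in> S1" if w: "x \<in> Q" "x \<in> S1" "w \<in> Q" for x w
      proof -
        have "(x, w) \<in> reach {e \<in> E. e \<subseteq> Q}"
          using less.prems(6)[OF \<open>Q \<in> \<P>\<close>] w by (auto simp: connected_induced_iff)
        then have "(x, w) \<in> reach E'" using QE by (rule reach_mono)
        then have "w \<in> S1 \<and> (x, w) \<in> reach {e \<in> E'. e \<subseteq> S1}"
          by (rule reach_closed[OF _ w(2)]) (rule stepS1)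
        then show ?thesis by blast
      qed
      then show ?thesis using PS[OF that] S12 by blast
    qed
    define P1 where "P1 = {Q \<in> \<P>. Q \<subseteq> S1}"
    define P2 where "P2 = {Q \<in> \<P>. Q \<subseteq> S2}"
    have P12: "P1 \<union> P2 = \<P>" using part by (auto simp: P1_def P2_def)
    have U1: "\<Union>P1 = S1"
    proof
      show "S1 \<subseteq> \<Union>P1"
      proof
        fix x assume x: "x \<in> S1"
        then obtain Q where "Q \<in> \<P>" "x \<in> Q" using S12 less.prems(4) by blast
        then show "x \<in> \<Union>P1" using part[of Q] x S12 by (auto simp: P1_def)
      qed
    qed (auto simp: P1_def)
    have U2: "\<Union>P2 = S2"
    proof
      show "S2 \<subseteq> \<Union>P2"
      proof
        fix x assume x: "x \<in> S2"
        then obtain Q where "Q \<in> \<P>" "x \<in> Q" using S12 less.prems(4) by blast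
        then show "x \<in> \<Union>P2" using part[of Q] x S12 by (auto simp: P2_def)
      qed
    qed (auto simp: P2_def)
    have "P1 \<noteq> {}" "P2 \<noteq> {}" using U1 U2 r1 s2 by auto
    moreover have "P1 \<inter> P2 = {}"
    proof (rule ccontr)
      assume "P1 \<inter> P2 \<noteq> {}"
      then obtain Q where "Q \<in> \<P>" "Q \<subseteq> S1 \<inter> S2" by (auto simp: P1_def P2_def)
      then show False using ne[of Q] S12 by simp
    qed
    ultimately have "P1 \<subset> \<P>" "P2 \<subset> \<P>" using P12 by auto
    then have card: "card P1 < card \<P>" "card P2 < card \<P>" using less.prems(1) by (simp_all add: psubset_card_mono)
    have fin: "finite P1" "finite P2" using less.prems(1) by (auto simp: P1_def P2_def)
    have "\<exists>xss. distinct (concat xss) \<and> set ` set xss = P1 \<and>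
        assembled \<theta> (pieces \<rho> A xss) (submat A (concat xss))"
    proof (rule less.hyps[OF card(1) fin(1) con1 _ U1])
      show "S1 \<subseteq> {..<n}" using less.prems(3) S12(2) by blast
      fix P Q assume "P \<in> P1" "Q \<in> P1"
      then show "P = Q \<or> P \<inter> Q = {}" by (intro less.prems(5)) (simp_all add: P1_def)
    next
      fix P assume "P \<in> P1"
      then show "connected_graph (induced G P)" by (intro less.prems(6)) (simp add: P1_def)
    next
      fix xs :: "nat list" assume "distinct xs" "set xs \<in> P1"
      then show "submat A xs \<in> role_set \<theta> (\<rho> (set xs))"
        by (intro less.prems(7)) (simp_all add: P1_def)
    qed
    then obtain xss where xss: "distinct (concat xss)" "set ` set xss = P1"
      "assembled \<theta> (pieces \<rho> A xss) (submat A (concat xss))" by blast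
    have "\<exists>xss. distinct (concat xss) \<and> set ` set xss = P2 \<and>
        assembled \<theta> (pieces \<rho> A xss) (submat A (concat xss))"
    proof (rule less.hyps[OF card(2) fin(2) con2 _ U2])
      show "S2 \<subseteq> {..<n}" using less.prems(3) S12(2) by blast
      fix P Q assume "P \<in> P2" "Q \<in> P2"
      then show "P = Q \<or> P \<inter> Q = {}" by (intro less.prems(5)) (simp_all add: P2_def)
    next
      fix P assume "P \<in> P2"
      then show "connected_graph (induced G P)" by (intro less.prems(6)) (simp add: P2_def)
    next
      fix xs :: "nat list" assume "distinct xs" "set xs \<in> P2"
      then show "submat A xs \<in> role_set \<theta> (\<rho> (set xs))"
        by (intro less.prems(7)) (simp_all add: P2_def)
    qed
    then obtain yss where yss: "distinct (concat yss)" "set ` set yss = P2"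
      "assembled \<theta> (pieces \<rho> A yss) (submat A (concat yss))" by blast
    have setx: "set (concat xss) = S1" using xss(2) U1 by auto
    have sety: "set (concat yss) = S2" using yss(2) U2 by auto
    obtain i where i: "i < length (concat xss)" "concat xss ! i = r"
      using r1 unfolding setx[symmetric] by (auto simp only: in_set_conv_nth)
    obtain j where j: "j < length (concat yss)" "concat yss ! j = s"
      using s2 unfolding sety[symmetric] by (auto simp only: in_set_conv_nth)
    have "connection (submat A (concat xss)) (submat A (concat yss)) i j (A $$ (r, s)) =
        submat A (concat xss @ concat yss)"
      unfolding i(2)[symmetric] j(2)[symmetric]
    proof (rule connection_submat[OF xss(1) yss(1) _ _ _ i(1) j(1)])
      show "set (concat xss) \<subseteq> {..<n}" "set (concat yss) \<subseteq> {..<n}"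
        unfolding setx sety using less.prems(3) S12(2) by blast+
      show "set (concat xss) \<inter> set (concat yss) = {}" unfolding setx sety by (rule S12(1))
      fix x y assume "x \<in> set (concat xss)" "y \<in> set (concat yss)" "{x, y} \<in> E"
      then show "x = concat xss ! i \<and> y = concat yss ! j"
        unfolding setx sety i(2) j(2) by (rule cross)
    qed
    moreover have "assembled \<theta> (pieces \<rho> A xss @ pieces \<rho> A yss)
        (connection (submat A (concat xss)) (submat A (concat yss)) i j (A $$ (r, s)))"
      by (rule connect[OF xss(3) yss(3)]) (use i j rs(3) in \<open>auto simp: edge_iff\<close>)
    ultimately have "assembled \<theta> (pieces \<rho> A (xss @ yss)) (submat A (concat (xss @ yss)))"
      by (simp add: pieces_append)
    moreover have "distinct (concat (xss @ yss))"
      unfolding concat_append distinct_append setx sety using xss(1) yss(1) S12(1) by blast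
    moreover have "set ` set (xss @ yss) = \<P>" using xss(2) yss(2) P12 by (simp add: image_Un)
    ultimately show ?thesis by blast
  qed
qed

end

section \<open>The parts of an acyclic matrix and their roles\<close>

context forest_matrix
begin

abbreviation "I \<equiv> induced G N\<^sub>i"

lemma simple_I: "simple_graph I"
  by (rule simple_graph_induced[OF simple]) (auto simp: interior_iff nodal_lt)

definition parts :: "nat set set" where
  "parts = components H \<union> components I \<union> (\<lambda>b. {b}) ` N\<^sub>b"

text \<open>A one-vertex part fits more than one role set, so the role is decided by the position
  relative to the nodal set and not by the submatrix.\<close>

definition role_of :: "nat set \<Rightarrow> role" where
  "role_of P = (if P \<inter> N = {} then Min_role else if P \<inter> N\<^sub>b = {} then Z_role else Link_role)"

lemma component_nonempty: "simple_graph K \<Longrightarrow> C \<in> components K \<Longrightarrow> C \<noteq> {}"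
  using component_connected[of K C] by (simp add: connected_induced_iff)

lemma parts_cases [consumes 1, case_names Min Z Link]:
  assumes "P \<in> parts"
  obtains "P \<in> components H" "P \<subseteq> {..<n} - N" "role_of P = Min_role"
  | "P \<in> components I" "P \<subseteq> N\<^sub>i" "role_of P = Z_role"
  | b where "b \<in> N\<^sub>b" "P = {b}" "role_of P = Link_role"
proof -
  consider "P \<in> components H" | "P \<in> components I" | b where "b \<in> N\<^sub>b" "P = {b}"
    using assms by (auto simp: parts_def)
  then show thesis
  proof cases
    case 1
    then have "P \<subseteq> {..<n} - N" using components_subset by fastforce
    moreover from this have "role_of P = Min_role" by (auto simp: role_of_def)
    ultimately show thesis using 1 that(1) by blast
  next
    case 2
    then have s: "P \<subseteq> N\<^sub>i" using components_subset by fastforce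
    moreover have "P \<noteq> {}" by (rule component_nonempty[OF simple_I 2])
    ultimately have "P \<inter> N \<noteq> {}" "P \<inter> N\<^sub>b = {}" using nodal_split by auto
    then have "role_of P = Z_role" by (simp add: role_of_def)
    then show thesis using 2 s that(2) by blast
  next
    case 3
    then have "role_of P = Link_role" using nodal_split by (simp add: role_of_def)
    then show thesis using 3 that(3) by blast
  qed
qed

lemma Union_parts: "\<Union>parts = {..<n}"
proof -
  have "\<Union>parts = ({..<n} - N) \<union> N\<^sub>i \<union> N\<^sub>b"
    using Union_components[of H] Union_components[of I] by (auto simp: parts_def)
  then show ?thesis using nodal_split nodal_lt by auto
qed

lemma parts_disjoint:
  assumes P: "P \<in> parts" and Q: "Q \<in> parts" shows "P = Q \<or> P \<inter> Q = {}"
  using P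
proof (cases rule: parts_cases)
  case Min
  note PM = this
  show ?thesis using Q
  proof (cases rule: parts_cases)
    case Min then show ?thesis using components_disjoint PM by blast
  qed (use PM nodal_split in auto)
next
  case Z
  note PZ = this
  show ?thesis using Q
  proof (cases rule: parts_cases)
    case Z then show ?thesis using components_disjoint PZ by blast
  qed (use PZ nodal_split in auto)
next
  case (Link b)
  note PL = this
  show ?thesis using Q by (cases rule: parts_cases) (use PL nodal_split in auto)
qed

lemma parts_connected:
  assumes "P \<in> parts" shows "connected_graph (induced G P)"
  using assms
proof (cases rule: parts_cases)
  case Min
  then show ?thesis using component_connected[OF simple_H, of P] by (simp add: induced_induced)
next
  case Z
  then show ?thesis using component_connected[OF simple_I, of P] by (simp add: induced_induced)
next
  case (Link b)
  then show ?thesis by (simp add: connected_induced_iff)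
qed

lemma parts_role_set:
  assumes xs: "distinct xs" and P: "set xs \<in> parts"
  shows "submat A xs \<in> role_set \<theta> (role_of (set xs))"
  using P
proof (cases rule: parts_cases)
  case Min
  then show ?thesis using submat_Min[OF xs] by simp
next
  case Z
  then show ?thesis using submat_Z[OF xs] by simp
next
  case (Link b)
  then have "length xs = 1" using distinct_card[OF xs] by simp
  then show ?thesis using Link submat_carrier[of A xs] by (simp add: Link_set_def)
qed

text \<open>A nodal neighbour of a non-nodal vertex is on the boundary, and all neighbours of an
  interior vertex are nodal. Hence edges leave such a part only towards linking vertices.\<close>

lemma parts_edge_closed:
  assumes P: "P \<in> parts" and r: "role_of P \<noteq> Link_role" and u: "u \<in> P"
    and e: "{u, v} \<in> E" and v: "v \<notin> N\<^sub>b"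
  shows "v \<in> P"
  using P
proof (cases rule: parts_cases)
  case Min
  have "{v, u} \<in> E" using e by (simp add: insert_commute)
  then have "v \<notin> N" using v Min u by (auto simp: boundary_iff)
  then have "{u, v} \<in> edges H" using e Min u by (auto simp: edge_iff)
  then show ?thesis by (rule component_edge_closed[OF simple_H Min(1) u])
next
  case Z
  then have "v \<in> N" using u e by (auto simp: interior_iff)
  then have "{u, v} \<in> edges I" using e Z u v nodal_split by auto
  then show ?thesis by (rule component_edge_closed[OF simple_I Z(1) u])
qed (use r in auto)

text \<open>
  The eigenvector equation of the generic eigenvector at a boundary vertex has a nonzero term,
  hence at least two; in a forest they belong to different components.
\<close>

lemma boundary_two_parts:
  assumes b: "b \<in> N\<^sub>b"
  obtains T1 T2 t1 t2 where "T1 \<in> components H" "T2 \<in> components H" "T1 \<noteq> T2"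
    "t1 \<in> T1" "{b, t1} \<in> E" "t2 \<in> T2" "{b, t2} \<in> E"
proof -
  have bN: "b \<in> N" "b < n" using b by (auto simp: boundary_iff nodal_lt)
  obtain t1 where t1: "{b, t1} \<in> E" "t1 \<notin> N" using b by (auto simp: boundary_iff)
  then have t1n: "t1 < n" "m b t1 \<noteq> 0" by (auto simp: edge_m)
  have "\<exists>t2<n. t2 \<noteq> t1 \<and> m b t2 * generic t2 \<noteq> 0"
  proof (rule ccontr)
    assume no: "\<not> (\<exists>t2<n. t2 \<noteq> t1 \<and> m b t2 * generic t2 \<noteq> 0)"
    have "mv generic b = (\<Sum>j<n. if j = t1 then m b t1 * generic t1 else 0)"
      unfolding mv_def by (rule sum.cong) (use no in auto)
    also have "\<dots> = m b t1 * generic t1" using t1n by simp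
    finally have "mv generic b \<noteq> 0" using t1n t1 generic(2) by simp
    then show False using generic(1) bN by (simp add: ker_def)
  qed
  then obtain t2 where t2: "t2 < n" "t2 \<noteq> t1" "m b t2 \<noteq> 0" "generic t2 \<noteq> 0" by auto
  have t2N: "t2 \<notin> N" using t2 generic(3) by blast
  then have e2: "{b, t2} \<in> E" using bN t2 by (auto simp: edge_m)
  have "cell t1 \<in> components H" "cell t2 \<in> components H"
    using t1 t1n t2 t2N by (auto simp: components_H)
  moreover have in1: "t1 \<in> cell t1" and in2: "t2 \<in> cell t2"
    using t1 t1n t2 t2N by (auto simp: cell_iff)
  moreover have "cell t1 \<noteq> cell t2"
  proof
    assume "cell t1 = cell t2"
    then have "t2 \<in> cell t1" using in2 by simp
    then have "(t1, t2) \<in> reach (edges H)" unfolding cell_iff by blast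
    \<comment> \<open>A walk outside the nodal set avoids \<open>b\<close>, so together with the
      edge from \<open>t2\<close> to \<open>b\<close> it would bypass the bridge
      \<open>{b, t1}\<close>.\<close>
    then have "(t1, t2) \<in> reach (E - {{b, t1}})" by (rule reach_mono) (use bN in auto)
    moreover have "{t2, b} \<in> E - {{b, t1}}" using e2 t2(2) by (auto simp: insert_commute doubleton_eq_iff)
    ultimately have "(t1, b) \<in> reach (E - {{b, t1}})" by (rule reach_step)
    then show False using forest_bridge[OF forest_G simple t1(1)] reach_sym[of t1 b] by blast
  qed
  ultimately show thesis using that t1(1) e2 by blast
qed

lemma component_by_construction:
  assumes S: "S \<in> components G"
  shows "\<exists>xs. distinct xs \<and> set xs = S \<and> by_construction \<theta> (submat A xs)"
proof -
  have Sn: "S \<subseteq> {..<n}" using components_subset[OF S] by simp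
  have Scon: "connected_graph (induced G S)" by (rule component_connected[OF simple S])
  define Ps where "Ps = {P \<in> parts. P \<subseteq> S}"
  \<comment> \<open>Parts are connected, so none of them straddles two components of
    \<open>G\<close>.\<close>
  have whole: "P \<subseteq> S" if "P \<in> parts" "P \<inter> S \<noteq> {}" for P
  proof (rule connected_subset_component[OF parts_connected[OF that(1)] _ S that(2)])
    show "P \<subseteq> verts G" using that(1) Union_parts by auto
  qed
  have "finite parts"
    by (rule finite_UnionD) (simp add: Union_parts)
  then have fin: "finite Ps" by (simp add: Ps_def)
  have U: "\<Union>Ps = S"
  proof
    show "S \<subseteq> \<Union>Ps"
    proof
      fix x assume x: "x \<in> S"
      then obtain P where "P \<in> parts" "x \<in> P" using Sn Union_parts by blast
      then show "x \<in> \<Union>Ps" using whole[of P] x by (auto simp: Ps_def)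
    qed
  qed (auto simp: Ps_def)
  have "\<exists>xss. distinct (concat xss) \<and> set ` set xss = Ps \<and>
    assembled \<theta> (pieces role_of A xss) (submat A (concat xss))"
  proof (rule assembled_partition[OF fin Scon Sn U])
    show "P = Q \<or> P \<inter> Q = {}" if "P \<in> Ps" "Q \<in> Ps" for P Q
      using that parts_disjoint[of P Q] by (simp add: Ps_def)
    show "connected_graph (induced G P)" if "P \<in> Ps" for P
      using that parts_connected by (simp add: Ps_def)
    show "submat A xs \<in> role_set \<theta> (role_of (set xs))" if "distinct xs" "set xs \<in> Ps" for xs
      using that parts_role_set by (simp add: Ps_def)
  qed
  then obtain xss where xss: "distinct (concat xss)" "set ` set xss = Ps"
    "assembled \<theta> (pieces role_of A xss) (submat A (concat xss))" by blast
  let ?C = "submat A (concat xss)" and ?ps = "pieces role_of A xss"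
  have setS: "set (concat xss) = S" using xss(2) U by auto
  have part: "set (xss ! i) \<in> parts" "set (xss ! i) \<subseteq> S" if "i < length xss" for i
  proof -
    have "set (xss ! i) \<in> Ps" unfolding xss(2)[symmetric] using that by simp
    then show "set (xss ! i) \<in> parts" "set (xss ! i) \<subseteq> S" by (auto simp: Ps_def)
  qed
  have idx: "\<exists>j<length xss. set (xss ! j) = P" if "P \<in> Ps" for P
  proof -
    have "P \<in> set ` set xss" using that xss(2) by simp
    then obtain xs where "xs \<in> set xss" "P = set xs" by blast
    then show ?thesis by (auto simp: in_set_conv_nth)
  qed
  have tree: "symmetric_mat ?C" "tree (graph_of ?C)"
    using submat_tree[OF xss(1)] setS Sn Scon by simp_all
  \<comment> \<open>A nonzero entry would be an edge out of a non-linking part whose other end is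
    off the boundary.\<close>
  have "\<not> linked ?ps ?C i j" if ij: "i < length xss" "j < length xss"
    and ri: "role_of (set (xss ! i)) \<noteq> Link_role" and rj: "role_of (set (xss ! j)) \<noteq> Link_role" for i j
  proof
    assume "linked ?ps ?C i j"
    then obtain u v where uv: "i \<noteq> j" "u \<in> set (xss ! i)" "v \<in> set (xss ! j)" "A $$ (u, v) \<noteq> 0"
      using ij by (auto simp: linked_pieces)
    have dis: "set (xss ! i) \<inter> set (xss ! j) = {}"
      by (rule distinct_concat_nth_disjoint[OF xss(1) ij uv(1)])
    have "u < n" "v < n" using uv part(2)[OF ij(1)] part(2)[OF ij(2)] Sn by auto
    moreover have "u \<noteq> v" using uv dis by blast
    ultimately have e: "{u, v} \<in> E" using uv by (simp add: edge_iff)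
    have "v \<notin> N\<^sub>b" using part(1)[OF ij(2)]
    proof (cases rule: parts_cases)
      case Min
      then show ?thesis using uv nodal_split by auto
    next
      case Z
      then show ?thesis using uv nodal_split by auto
    qed (use rj in simp)
    then have "v \<in> set (xss ! i)" by (rule parts_edge_closed[OF part(1)[OF ij(1)] ri uv(2) e])
    then show False using uv dis by blast
  qed
  then have c2: "\<forall>i<length ?ps. \<forall>j<length ?ps. fst (?ps ! i) \<in> {Z_role, Min_role} \<longrightarrow>
      fst (?ps ! j) \<in> {Z_role, Min_role} \<longrightarrow> \<not> linked ?ps ?C i j" by auto
  have c3: "2 \<le> card {j. j < length xss \<and> fst (?ps ! j) = Min_role \<and> linked ?ps ?C i j}" (is "2 \<le> card ?J")
    if i: "i < length xss" "role_of (set (xss ! i)) = Link_role" for i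
    using part(1)[OF i(1)]
  proof (cases rule: parts_cases)
    case (Link b)
    obtain T1 T2 t1 t2 where T: "T1 \<in> components H" "T2 \<in> components H" "T1 \<noteq> T2"
      and t: "t1 \<in> T1" "{b, t1} \<in> E" "t2 \<in> T2" "{b, t2} \<in> E"
      by (rule boundary_two_parts[OF Link(1)])
    have bS: "b \<in> S" using part(2)[OF i(1)] Link by simp
    \<comment> \<open>A neighbour of \<open>b\<close> lies in the same component of
      \<open>G\<close>, so its part occurs among the pieces.\<close>
    have J: "\<exists>j\<in>?J. set (xss ! j) = T" if T: "T \<in> components H" "t \<in> T" "{b, t} \<in> E" for T t
    proof -
      have tS: "t \<in> S" by (rule component_edge_closed[OF simple S bS T(3)])
      have Tp: "T \<in> parts" using T by (simp add: parts_def)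
      then have "T \<in> Ps" using whole[OF Tp] T(2) tS by (auto simp: Ps_def)
      then obtain j where j: "j < length xss" "set (xss ! j) = T" using idx by blast
      have "T \<subseteq> {..<n} - N" using components_subset[OF T(1)] by simp
      then have "role_of T = Min_role" by (auto simp: role_of_def)
      moreover from this have "i \<noteq> j" using i j by auto
      moreover have "A $$ (b, t) \<noteq> 0" using T(3) by (simp add: edge_iff)
      ultimately have "j \<in> ?J" using i j T Link by (auto simp: linked_pieces)
      then show ?thesis using j by blast
    qed
    obtain j1 where j1: "j1 \<in> ?J" "set (xss ! j1) = T1" using J[OF T(1) t(1,2)] by blast
    obtain j2 where j2: "j2 \<in> ?J" "set (xss ! j2) = T2" using J[OF T(2) t(3,4)] by blast
    have "j1 \<noteq> j2" using j1 j2 T(3) by blast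
    then have "card {j1, j2} = 2" by simp
    moreover have "card {j1, j2} \<le> card ?J" by (rule card_mono) (use j1(1) j2(1) in auto)
    ultimately show ?thesis by linarith
  qed (use i in simp_all)
  have "by_construction \<theta> ?C"
    unfolding by_construction_def
  proof (intro exI[of _ ?ps] conjI)
    show "assembled \<theta> ?ps ?C" by (rule xss(3))
    show "acyclic_mat ?C" using tree by (simp add: acyclic_mat_def tree_def)
    show "irreducible_mat ?C" using connected_imp_irreducible tree by (simp add: tree_def)
    show "\<forall>i<length ?ps. fst (?ps ! i) = Link_role \<longrightarrow>
        2 \<le> card {j. j < length ?ps \<and> fst (?ps ! j) = Min_role \<and> linked ?ps ?C i j}"
      using c3 by simp
  qed (rule c2)
  then show ?thesis using xss(1) setS by blast
qed

text \<open>Listing the vertices component by component produces a direct sum, because entries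
  between different components vanish; conjugation by a permutation matrix then recovers
  \<open>A\<close>.\<close>

lemma in_A_set: "A \<in> A_set \<theta>"
proof -
  obtain Ss where Ss: "set Ss = components G" "distinct Ss"
    using finite_distinct_list[OF finite_components[OF simple]] by blast
  have "\<exists>f. \<forall>S. S \<in> components G \<longrightarrow>
      distinct (f S) \<and> set (f S) = S \<and> by_construction \<theta> (submat A (f S))"
  proof (intro choice allI)
    fix S
    show "\<exists>xs. S \<in> components G \<longrightarrow> distinct xs \<and> set xs = S \<and> by_construction \<theta> (submat A xs)"
      using component_by_construction[of S] by blast
  qed
  then obtain f where "\<forall>S. S \<in> components G \<longrightarrow>
      distinct (f S) \<and> set (f S) = S \<and> by_construction \<theta> (submat A (f S))" ..
  then have f: "distinct (f S) \<and> set (f S) = S \<and> by_construction \<theta> (submat A (f S))"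
    if "S \<in> components G" for S using that by blast
  define zs where "zs = concat (map f Ss)"
  have setz: "set zs = {..<n}"
  proof -
    have "set zs = (\<Union>S\<in>components G. set (f S))" by (simp add: zs_def Ss(1))
    also have "\<dots> = (\<Union>S\<in>components G. S)" by (rule SUP_cong) (use f in simp_all)
    finally show ?thesis by (simp add: Union_components)
  qed
  have dis: "S \<inter> T = {}" if "S \<in> components G" "T \<in> components G" "S \<noteq> T" for S T
    using components_disjoint[OF that(1,2)] that(3) by blast
  have dz: "distinct zs"
    unfolding zs_def
  proof (rule distinct_concat)
    show "distinct (map f Ss)"
      unfolding distinct_map
    proof (rule conjI)
      show "inj_on f (set Ss)"
      proof (rule inj_onI)
        fix S T assume ST: "S \<in> set Ss" "T \<in> set Ss" and eq: "f S = f T"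
        have S: "set (f S) = S" and T: "set (f T) = T" using ST f Ss(1) by blast+
        show "S = T" by (rule trans[OF S[symmetric]]) (simp only: eq T)
      qed
    qed (rule Ss(2))
    show "distinct ys" if ys: "ys \<in> set (map f Ss)" for ys
    proof -
      obtain S where "S \<in> components G" "ys = f S" using ys Ss(1) by auto
      then show ?thesis using f[of S] by simp
    qed
    show "set ys \<inter> set ws = {}"
      if ys: "ys \<in> set (map f Ss)" and ws: "ws \<in> set (map f Ss)" and ne: "ys \<noteq> ws" for ys ws
    proof -
      obtain S where S: "S \<in> components G" "ys = f S" using ys Ss(1) by auto
      obtain T where T: "T \<in> components G" "ws = f T" using ws Ss(1) by auto
      have "S \<noteq> T" using S T ne by blast
      then show ?thesis using dis[OF S(1) T(1)] f[OF S(1)] f[OF T(1)] S T by simp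
    qed
  qed
  then have len: "length zs = n" using distinct_card[of zs] setz by simp
  have diag: "diag_block_mat (map (submat A) (map f Ss)) = submat A zs"
    unfolding zs_def
  proof (rule diag_block_mat_submat)
    have *: "A $$ (u, v) = 0" if "S \<in> components G" "T \<in> components G" "S \<noteq> T" "u \<in> S" "v \<in> T" for S T u v
    proof -
      have "u \<noteq> v" using dis[OF that(1-3)] that by blast
      have "v \<notin> S" using dis[OF that(1-3)] that by blast
      then have "{u, v} \<notin> E" using component_edge_closed[OF simple that(1,4), of v] by blast
      moreover have "u < n" "v < n"
        using subsetD[OF components_subset[OF that(1)] that(4)]
          subsetD[OF components_subset[OF that(2)] that(5)] by simp_all
      ultimately show ?thesis using \<open>u \<noteq> v\<close> by (simp add: edge_iff)
    qed
    have "sorted_wrt (\<noteq>) Ss" using Ss(2) by (simp add: distinct_conv_nth sorted_wrt_iff_nth_less)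
    then show "sorted_wrt (\<lambda>xs ys. \<forall>u\<in>set xs. \<forall>v\<in>set ys. A $$ (u, v) = 0 \<and> A $$ (v, u) = 0) (map f Ss)"
      unfolding sorted_wrt_map
    proof (rule sorted_wrt_mono_rel[rotated])
      fix S T assume "S \<in> set Ss" "T \<in> set Ss" "S \<noteq> T"
      then show "\<forall>u\<in>set (f S). \<forall>v\<in>set (f T). A $$ (u, v) = 0 \<and> A $$ (v, u) = 0"
        using f[of S] f[of T] *[of S T] *[of T S] by (simp add: Ss(1))
    qed
  qed
  \<comment> \<open>It sends a position of the listing to its vertex, and is the identity from
    \<open>n\<close> on, as \<open>permutes\<close> requires.\<close>
  define \<sigma> where "\<sigma> j = (if j < n then zs ! j else j)" for j
  have "bij_betw \<sigma> {..<n} {..<n}"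
  proof -
    have "bij_betw ((!) zs) {..<n} {..<n}"
      by (rule bij_betw_nth) (use dz setz len in auto)
    then show ?thesis by (rule iffD1[OF bij_betw_cong, rotated]) (simp add: \<sigma>_def)
  qed
  then have \<sigma>: "\<sigma> permutes {..<n}" by (rule bij_imp_permutes) (simp add: \<sigma>_def)
  define P where "P = mat n n (\<lambda>(i, j). if i = \<sigma> j then 1 else (0::real))"
  have "P * submat A zs * P\<^sup>T = mat n n (\<lambda>(i, j). submat A zs $$ (inv_into UNIV \<sigma> i, inv_into UNIV \<sigma> j))"
    by (rule permutation_conjugate[OF \<sigma> P_def]) (use submat_carrier[of A zs] len in simp)
  also have "\<dots> = A"
  proof (rule eq_matI)
    fix i j assume "i < dim_row A" "j < dim_col A"
    then have ij: "i < n" "j < n" by auto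
    have *: "inv_into UNIV \<sigma> k < n \<and> zs ! inv_into UNIV \<sigma> k = k" if "k < n" for k
    proof -
      have lt: "inv_into UNIV \<sigma> k < n"
        using permutes_in_image[OF permutes_inv[OF \<sigma>], of k] that by simp
      have "\<sigma> (inv_into UNIV \<sigma> k) = k" using permutes_inverses(1)[OF \<sigma>] .
      then show ?thesis using lt by (simp add: \<sigma>_def)
    qed
    show "mat n n (\<lambda>(i, j). submat A zs $$ (inv_into UNIV \<sigma> i, inv_into UNIV \<sigma> j)) $$ (i, j) = A $$ (i, j)"
      using ij *[OF ij(1)] *[OF ij(2)] len by simp
  qed auto
  finally have eq: "A = P * diag_block_mat (map (submat A) (map f Ss)) * P\<^sup>T" unfolding diag by simp
  show ?thesis
    unfolding A_set_def
  proof (intro CollectI exI conjI)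
    show "A = P * diag_block_mat (map (submat A) (map f Ss)) * P\<^sup>T" by (rule eq)
    show "permutation_mat (dim_row (diag_block_mat (map (submat A) (map f Ss)))) P"
      unfolding diag permutation_mat_def using \<sigma> P_def len by auto
    show "\<forall>B\<in>set (map (submat A) (map f Ss)). by_construction \<theta> B"
    proof
      fix B assume "B \<in> set (map (submat A) (map f Ss))"
      then obtain S where "S \<in> components G" "B = submat A (f S)" using Ss(1) by auto
      then show "by_construction \<theta> B" using f[of S] by simp
    qed
  qed
qed

end

theorem theorem2p8:
  fixes \<theta> :: real and A :: "real mat" and n :: nat and F :: "nat ugraph"
  assumes "A \<in> carrier_mat n n"
    and "symmetric_mat A"
    and "acyclic_mat A"
    and "F = \<lparr>verts = verts (graph_of A) - nodal_interior \<theta> A,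
              edges = edges (graph_of A) - nodal_edges \<theta> A\<rparr>"
  shows "A \<in> A_set \<theta> \<and>
     int (eig_mult \<theta> A) =
       int (card (components F)) + (\<Sum>u\<in>nodal_boundary \<theta> A. int (degree_in F u) - 2) \<and>
     int (eig_mult \<theta> A) =
       int (card (components (delete_verts F (nodal_boundary \<theta> A))))
         - int (card (nodal_boundary \<theta> A))"
proof -
  interpret fm: forest_matrix A \<theta> n by unfold_locales (use assms in auto)
  have "F = fm.F" using assms(1,4) by (simp add: fm.F_def)
  then show ?thesis
    using fm.in_A_set fm.eig_mult_degrees fm.eig_mult_components by simp
qed

end
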